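(* Let $K$ be a field, and let $n,d\ge1$. The diagram of functors $$\begin{array}{ccc}\mathrm{Rep}\,\mathbf\Gamma^d&\xrightarrow{\ \mathrm{Res}^d\ }&\mathrm{FI}\text{-}\mathrm{Mod}\\ {\scriptstyle \mathrm{ev}_n}\downarrow&&\downarrow{\scriptstyle \mathrm{ev}_n}\\ \mathrm{Rep}^d\,GL_n(K)&\xrightarrow{\mathrm{Res}^{GL_n(K)}_{S_n}}&\mathrm{Rep}\,S_n\end{array}$$ commutes, in the sense that $\mathrm{Res}^{GL_n(K)}_{S_n}\circ\mathrm{ev}_n$ is naturally isomorphic to $\mathrm{ev}_n\circ\mathrm{Res}^d$.
   Context: $K$ is an arbitrary field. $\mathbf\Gamma^d$ is the category whose objects are finite-dimensional $K$-vector spaces, with $\mathrm{Hom}_{\mathbf\Gamma^d}(V,W)=\mathrm{Hom}_{S_d}(V^{\otimes d},W^{\otimes d})$ and the usual composition. $\mathrm{Rep}\,\mathbf\Gamma^d$ (strict polynomial functors of degree $d$) is the category of $K$-linear covariant functors from $\mathbf\Gamma^d$ to $K$-vector spaces, with natural transformations as morphisms. $\mathrm{Rep}^dGL_n(K)$ is the category of homogeneous polynomial representations of $GL_n(K)$ of degree $d$. The functor $\mathrm{ev}_n:\mathrm{Rep}\,\mathbf\Gamma^d\to\mathrm{Rep}^dGL_n(K)$ is $\mathrm{ev}_n(F)=F(K^n)$, with $T\in GL_n(K)$ acting by $F(T^{\otimes d})$. $\mathrm{FI}$ is the category of finite sets and injective maps; $\mathrm{FI}\text{-}\mathrm{Mod}$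 is the category of covariant functors from $\mathrm{FI}$ to $K$-vector spaces, with natural transformations. $\mathrm{Rep}\,S_n$ is the category of representations of $S_n$ over $K$. The functor $\mathrm{ev}_n:\mathrm{FI}\text{-}\mathrm{Mod}\to\mathrm{Rep}\,S_n$ is $\mathrm{ev}_n(V)=V([n])$, $[n]=\{1,\dots,n\}$. For a finite set $A$ let $\mathcal F[A]$ be the vector space of functions $A\to K$; for an injection $i:A\to B$ let $\mathcal F(i):\mathcal F[A]\to\mathcal F[B]$ be $\mathcal F(i)(f)(b)=f(a)$ if $b=i(a)$ for some $a\in A$, and $0$ if $b\notin i(A)$. Define $\mathcal F^d:\mathrm{FI}\to\mathbf\Gamma^d$ by $\mathcal F^d(A)=\mathcal F[A]$, $\mathcal F^d(i)=\mathcal F(i)^{\otimes d}$. The functor $\mathrm{Res}^d:\mathrm{Rep}\,\mathbf\Gamma^d\to\mathrm{FI}\text{-}\mathrm{Mod}$ is $\mathrm{Res}^dF=F\circ\mathcal F^d$. $\mathrm{Res}^{GL_n(K)}_{S_n}$ is restriction to the subgroup $S_n\subset GL_n(K)$ of permutation matrices ($w$ acts by $e_i\mapsto e_{w(i)}$). *)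

theory Defs
  imports
    "Jordan_Normal_Form.VS_Connect"
    "HOL-Algebra.AbelCoset"
    "HOL-Algebra.Sym_Groups"
    "HOL-Library.Poly_Mapping"
begin

hide_const (open) Modules.module_hom Modules.module Multiset.mult

section \<open>Categories, functors, natural transformations\<close>

record ('o, 'm) category =
  Obj :: "'o set"
  Mor :: "'o \<Rightarrow> 'o \<Rightarrow> 'm set"
  Idm :: "'o \<Rightarrow> 'm"
  Cmp :: "'o \<Rightarrow> 'o \<Rightarrow> 'o \<Rightarrow> 'm \<Rightarrow> 'm \<Rightarrow> 'm"

text \<open>\<open>Cmp C A B D g f\<close> is the composite of \<open>f : A \<rightarrow> B\<close> and \<open>g : B \<rightarrow> D\<close>. Hom-sets of different
  pairs of objects may overlap, so compositions and functors are told source and target.\<close>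

definition is_category :: "('o, 'm) category \<Rightarrow> bool" where
  "is_category C \<longleftrightarrow>
     (\<forall>A\<in>Obj C. Idm C A \<in> Mor C A A) \<and>
     (\<forall>A\<in>Obj C. \<forall>B\<in>Obj C. \<forall>D\<in>Obj C. \<forall>f\<in>Mor C A B. \<forall>g\<in>Mor C B D.
        Cmp C A B D g f \<in> Mor C A D) \<and>
     (\<forall>A\<in>Obj C. \<forall>B\<in>Obj C. \<forall>f\<in>Mor C A B.
        Cmp C A A B f (Idm C A) = f \<and> Cmp C A B B (Idm C B) f = f) \<and>
     (\<forall>A\<in>Obj C. \<forall>B\<in>Obj C. \<forall>D\<in>Obj C. \<forall>E\<in>Obj C.
        \<forall>f\<in>Mor C A B. \<forall>g\<in>Mor C B D. \<forall>h\<in>Mor C D E.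
        Cmp C A D E h (Cmp C A B D g f) = Cmp C A B E (Cmp C B D E h g) f)"

record ('o1, 'm1, 'o2, 'm2) fctr =
  fob :: "'o1 \<Rightarrow> 'o2"
  fmor :: "'o1 \<Rightarrow> 'o1 \<Rightarrow> 'm1 \<Rightarrow> 'm2"

definition is_functor ::
  "('o1, 'm1) category \<Rightarrow> ('o2, 'm2) category \<Rightarrow> ('o1, 'm1, 'o2, 'm2) fctr \<Rightarrow> bool" where
  "is_functor C D F \<longleftrightarrow> is_category C \<and> is_category D \<and>
     (\<forall>A\<in>Obj C. fob F A \<in> Obj D) \<and>
     (\<forall>A\<in>Obj C. \<forall>B\<in>Obj C. \<forall>f\<in>Mor C A B. fmor F A B f \<in> Mor D (fob F A) (fob F B)) \<and>
     (\<forall>A\<in>Obj C. fmor F A A (Idm C A) = Idm D (fob F A)) \<and>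
     (\<forall>A\<in>Obj C. \<forall>B\<in>Obj C. \<forall>E\<in>Obj C. \<forall>f\<in>Mor C A B. \<forall>g\<in>Mor C B E.
        fmor F A E (Cmp C A B E g f)
          = Cmp D (fob F A) (fob F B) (fob F E) (fmor F B E g) (fmor F A B f))"

definition fctr_comp ::
  "('o2, 'm2, 'o3, 'm3) fctr \<Rightarrow> ('o1, 'm1, 'o2, 'm2) fctr \<Rightarrow> ('o1, 'm1, 'o3, 'm3) fctr" where
  "fctr_comp G F = \<lparr>
     fob = \<lambda>A. fob G (fob F A),
     fmor = \<lambda>A B f. fmor G (fob F A) (fob F B) (fmor F A B f)\<rparr>"

definition nat_trans ::
  "('o1, 'm1) category \<Rightarrow> ('o2, 'm2) category \<Rightarrow> ('o1, 'm1, 'o2, 'm2) fctr \<Rightarrow>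
   ('o1, 'm1, 'o2, 'm2) fctr \<Rightarrow> ('o1 \<Rightarrow> 'm2) \<Rightarrow> bool" where
  "nat_trans C D F G \<eta> \<longleftrightarrow>
     \<eta> \<in> extensional (Obj C) \<and>
     (\<forall>A\<in>Obj C. \<eta> A \<in> Mor D (fob F A) (fob G A)) \<and>
     (\<forall>A\<in>Obj C. \<forall>B\<in>Obj C. \<forall>f\<in>Mor C A B.
        Cmp D (fob F A) (fob F B) (fob G B) (\<eta> B) (fmor F A B f)
          = Cmp D (fob F A) (fob G A) (fob G B) (fmor G A B f) (\<eta> A))"

definition is_iso :: "('o, 'm) category \<Rightarrow> 'o \<Rightarrow> 'o \<Rightarrow> 'm \<Rightarrow> bool" where
  "is_iso C A B f \<longleftrightarrow> f \<in> Mor C A B \<and>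
     (\<exists>g\<in>Mor C B A. Cmp C A B A g f = Idm C A \<and> Cmp C B A B f g = Idm C B)"

definition naturally_isomorphic ::
  "('o1, 'm1) category \<Rightarrow> ('o2, 'm2) category \<Rightarrow> ('o1, 'm1, 'o2, 'm2) fctr \<Rightarrow>
   ('o1, 'm1, 'o2, 'm2) fctr \<Rightarrow> bool" where
  "naturally_isomorphic C D F G \<longleftrightarrow> is_functor C D F \<and> is_functor C D G \<and>
     (\<exists>\<eta>. nat_trans C D F G \<eta> \<and> (\<forall>A\<in>Obj C. is_iso D (fob F A) (fob G A) (\<eta> A)))"

definition functor_cat ::
  "('o1, 'm1) category \<Rightarrow> ('o2, 'm2) category \<Rightarrow> (('o1, 'm1, 'o2, 'm2) fctr \<Rightarrow> bool) \<Rightarrow>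
   (('o1, 'm1, 'o2, 'm2) fctr, 'o1 \<Rightarrow> 'm2) category" where
  "functor_cat C D P = \<lparr>
     Obj = {F. is_functor C D F \<and> P F},
     Mor = \<lambda>F G. {\<eta>. nat_trans C D F G \<eta>},
     Idm = \<lambda>F. \<lambda>A\<in>Obj C. Idm D (fob F A),
     Cmp = \<lambda>F G H \<epsilon> \<eta>. \<lambda>A\<in>Obj C. Cmp D (fob F A) (fob G A) (fob H A) (\<epsilon> A) (\<eta> A)\<rparr>"


section \<open>Vector spaces and tensor powers\<close>

text \<open>The ground field is a type of class \<^class>\<open>field\<close>, i.e. the ring \<^term>\<open>class_ring\<close>. A linear
  map is fixed to be \<^const>\<open>undefined\<close> off its domain, so that equal maps are equal functions.\<close>

definition lin_maps ::
  "('k::field, 'v) module \<Rightarrow> ('k, 'w) module \<Rightarrow> ('v \<Rightarrow> 'w) set" where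
  "lin_maps V W = module_hom class_ring V W \<inter> extensional (carrier V)"

definition Vect :: "(('k::field, 'w) module, 'w \<Rightarrow> 'w) category" where
  "Vect = \<lparr>
     Obj = {W. vectorspace class_ring W},
     Mor = lin_maps,
     Idm = \<lambda>W. \<lambda>x\<in>carrier W. x,
     Cmp = \<lambda>U V W g f. compose (carrier U) g f\<rparr>"

definition free_space :: "'t set \<Rightarrow> ('k::field, 't \<Rightarrow>\<^sub>0 'k) module" where
  "free_space X = \<lparr>
     carrier = {p. Poly_Mapping.keys p \<subseteq> X},
     mult = undefined, one = undefined,
     zero = 0, add = (+),
     smult = \<lambda>c. Poly_Mapping.map ((*) c)\<rparr>"

definition quotient_space :: "('k, 'v) module \<Rightarrow> 'v set \<Rightarrow> ('k, 'v set) module" where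
  "quotient_space M N = \<lparr>
     carrier = A_RCOSETS M N,
     mult = undefined, one = undefined,
     zero = N, add = set_add M,
     smult = \<lambda>c X. set_add M N ((\<lambda>x. c \<odot>\<^bsub>M\<^esub> x) ` X)\<rparr>"

text \<open>The \<open>d\<close>-th tensor power is the free space on \<open>d\<close>-tuples modulo the multilinearity relations.\<close>

definition tuples :: "nat \<Rightarrow> ('k, 'v) module \<Rightarrow> (nat \<Rightarrow> 'v) set" where
  "tuples d V = {1..d} \<rightarrow>\<^sub>E carrier V"

definition multilin_rels ::
  "nat \<Rightarrow> ('k::field, 'v) module \<Rightarrow> ((nat \<Rightarrow> 'v) \<Rightarrow>\<^sub>0 'k) set" where
  "multilin_rels d V =
     {Poly_Mapping.single (x(k := u \<oplus>\<^bsub>V\<^esub> v)) 1 - Poly_Mapping.single (x(k := u)) 1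
        - Poly_Mapping.single (x(k := v)) 1 | x k u v.
        x \<in> tuples d V \<and> k \<in> {1..d} \<and> u \<in> carrier V \<and> v \<in> carrier V} \<union>
     {Poly_Mapping.single (x(k := c \<odot>\<^bsub>V\<^esub> u)) 1 - Poly_Mapping.single (x(k := u)) c | x k u c.
        x \<in> tuples d V \<and> k \<in> {1..d} \<and> u \<in> carrier V}"

definition tensor_rels ::
  "nat \<Rightarrow> ('k::field, 'v) module \<Rightarrow> ((nat \<Rightarrow> 'v) \<Rightarrow>\<^sub>0 'k) set" where
  "tensor_rels d V = LinearCombinations.module.span class_ring (free_space (tuples d V)) (multilin_rels d V)"

type_synonym ('k, 'v) tensor = "((nat \<Rightarrow> 'v) \<Rightarrow>\<^sub>0 'k) set"

definition tensor_power :: "nat \<Rightarrow> ('k::field, 'v) module \<Rightarrow> ('k, ('k, 'v) tensor) module" where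
  "tensor_power d V = quotient_space (free_space (tuples d V)) (tensor_rels d V)"

text \<open>The map of tensor powers induced by a map \<open>g\<close> of tuples whose linear extension preserves the
  relations: \<open>X\<close> is a coset, and adding the relations to its image gives the coset of the image.\<close>

definition free_map :: "('s \<Rightarrow> 't) \<Rightarrow> ('s \<Rightarrow>\<^sub>0 'k::field) \<Rightarrow> ('t \<Rightarrow>\<^sub>0 'k)" where
  "free_map g p =
     (\<Sum>x\<in>Poly_Mapping.keys p. Poly_Mapping.single (g x) (Poly_Mapping.lookup p x))"

definition tensor_induced ::
  "nat \<Rightarrow> ('k::field, 'v) module \<Rightarrow> ('k, 'w) module \<Rightarrow> ((nat \<Rightarrow> 'v) \<Rightarrow> (nat \<Rightarrow> 'w)) \<Rightarrow>
   ('k, 'v) tensor \<Rightarrow> ('k, 'w) tensor" where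
  "tensor_induced d V W g =
     (\<lambda>X\<in>carrier (tensor_power d V).
        set_add (free_space (tuples d W)) (tensor_rels d W) (free_map g ` X))"

text \<open>\<open>tensor_map d V W T\<close> is the \<open>d\<close>-th tensor power of the linear map \<open>T : V \<rightarrow> W\<close>.\<close>

definition tensor_map ::
  "nat \<Rightarrow> ('k::field, 'v) module \<Rightarrow> ('k, 'w) module \<Rightarrow> ('v \<Rightarrow> 'w) \<Rightarrow>
   ('k, 'v) tensor \<Rightarrow> ('k, 'w) tensor" where
  "tensor_map d V W T = tensor_induced d V W (\<lambda>x. \<lambda>k\<in>{1..d}. T (x k))"

definition tensor_perm ::
  "nat \<Rightarrow> ('k::field, 'v) module \<Rightarrow> (nat \<Rightarrow> nat) \<Rightarrow> ('k, 'v) tensor \<Rightarrow> ('k, 'v) tensor" where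
  "tensor_perm d V \<pi> = tensor_induced d V V (\<lambda>x. \<lambda>k\<in>{1..d}. x (inv' \<pi> k))"


section \<open>Strict polynomial functors\<close>

definition Gamma :: "nat \<Rightarrow> (('k::field, 'v) module, ('k, 'v) tensor \<Rightarrow> ('k, 'v) tensor) category" where
  "Gamma d = \<lparr>
     Obj = {V. vectorspace class_ring V \<and> vectorspace.fin_dim class_ring V},
     Mor = \<lambda>V W. {f \<in> lin_maps (tensor_power d V) (tensor_power d W).
                    \<forall>\<pi>\<in>carrier (sym_group d). \<forall>X\<in>carrier (tensor_power d V).
                      f (tensor_perm d V \<pi> X) = tensor_perm d W \<pi> (f X)},
     Idm = \<lambda>V. \<lambda>X\<in>carrier (tensor_power d V). X,
     Cmp = \<lambda>U V W g f. compose (carrier (tensor_power d U)) g f\<rparr>"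

definition hom_add ::
  "('k, 'v) module \<Rightarrow> ('k, 'w) module \<Rightarrow> ('v \<Rightarrow> 'w) \<Rightarrow> ('v \<Rightarrow> 'w) \<Rightarrow> 'v \<Rightarrow> 'w" where
  "hom_add V W f g = (\<lambda>x\<in>carrier V. f x \<oplus>\<^bsub>W\<^esub> g x)"

definition hom_smult ::
  "('k, 'v) module \<Rightarrow> ('k, 'w) module \<Rightarrow> 'k \<Rightarrow> ('v \<Rightarrow> 'w) \<Rightarrow> 'v \<Rightarrow> 'w" where
  "hom_smult V W c f = (\<lambda>x\<in>carrier V. c \<odot>\<^bsub>W\<^esub> f x)"

type_synonym ('k, 'v, 'w) Gamma_fctr =
  "(('k, 'v) module, ('k, 'v) tensor \<Rightarrow> ('k, 'v) tensor, ('k, 'w) module, 'w \<Rightarrow> 'w) fctr"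

definition K_linear :: "nat \<Rightarrow> ('k::field, 'v, 'w) Gamma_fctr \<Rightarrow> bool" where
  "K_linear d F \<longleftrightarrow>
     (\<forall>V\<in>Obj (Gamma d). \<forall>W\<in>Obj (Gamma d). \<forall>f\<in>Mor (Gamma d) V W.
        (\<forall>g\<in>Mor (Gamma d) V W.
           fmor F V W (hom_add (tensor_power d V) (tensor_power d W) f g)
             = hom_add (fob F V) (fob F W) (fmor F V W f) (fmor F V W g)) \<and>
        (\<forall>c. fmor F V W (hom_smult (tensor_power d V) (tensor_power d W) c f)
             = hom_smult (fob F V) (fob F W) c (fmor F V W f)))"

definition Rep_Gamma ::
  "nat \<Rightarrow> (('k::field, 'v, 'w) Gamma_fctr, ('k, 'v) module \<Rightarrow> 'w \<Rightarrow> 'w) category" where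
  "Rep_Gamma d = functor_cat (Gamma d) Vect (K_linear d)"


section \<open>FI-modules\<close>

definition FI :: "('b set, 'b \<Rightarrow> 'b) category" where
  "FI = \<lparr>
     Obj = {A. finite A},
     Mor = \<lambda>A B. {i \<in> A \<rightarrow>\<^sub>E B. inj_on i A},
     Idm = \<lambda>A. \<lambda>a\<in>A. a,
     Cmp = \<lambda>A B D j i. compose A j i\<rparr>"

type_synonym ('k, 'b, 'w) FI_fctr = "('b set, 'b \<Rightarrow> 'b, ('k, 'w) module, 'w \<Rightarrow> 'w) fctr"

definition FI_Mod :: "(('k::field, 'b, 'w) FI_fctr, 'b set \<Rightarrow> 'w \<Rightarrow> 'w) category" where
  "FI_Mod = functor_cat FI Vect (\<lambda>_. True)"


section \<open>Group representations\<close>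

type_synonym ('k, 'g, 'w) repr = "('k, 'w) module \<times> ('g \<Rightarrow> 'w \<Rightarrow> 'w)"

definition is_rep :: "'g monoid \<Rightarrow> ('k::field, 'g, 'w) repr \<Rightarrow> bool" where
  "is_rep G = (\<lambda>(W, \<rho>). vectorspace class_ring W \<and>
     (\<forall>g\<in>carrier G. \<rho> g \<in> lin_maps W W) \<and>
     \<rho> \<one>\<^bsub>G\<^esub> = (\<lambda>x\<in>carrier W. x) \<and>
     (\<forall>g\<in>carrier G. \<forall>h\<in>carrier G. \<rho> (g \<otimes>\<^bsub>G\<^esub> h) = compose (carrier W) (\<rho> g) (\<rho> h)))"

definition rep_cat ::
  "'g monoid \<Rightarrow> (('k::field, 'g, 'w) repr \<Rightarrow> bool) \<Rightarrow> (('k, 'g, 'w) repr, 'w \<Rightarrow> 'w) category" where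
  "rep_cat G P = \<lparr>
     Obj = {R. is_rep G R \<and> P R},
     Mor = \<lambda>R S. {f \<in> lin_maps (fst R) (fst S).
                    \<forall>g\<in>carrier G. \<forall>x\<in>carrier (fst R). f (snd R g x) = snd S g (f x)},
     Idm = \<lambda>R. \<lambda>x\<in>carrier (fst R). x,
     Cmp = \<lambda>R S T g f. compose (carrier (fst R)) g f\<rparr>"

definition Rep_S :: "nat \<Rightarrow> (('k::field, nat \<Rightarrow> nat, 'w) repr, 'w \<Rightarrow> 'w) category" where
  "Rep_S n = rep_cat (sym_group n) (\<lambda>_. True)"

definition GL :: "nat \<Rightarrow> 'k::field mat monoid" where
  "GL n = units_of (ring_mat TYPE('k) n ())"

definition homogeneous_polynomial_on_GL :: "nat \<Rightarrow> nat \<Rightarrow> ('k::field mat \<Rightarrow> 'k) \<Rightarrow> bool" where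
  "homogeneous_polynomial_on_GL d n \<phi> \<longleftrightarrow>
     (\<exists>c. \<forall>T\<in>carrier (GL n).
        \<phi> T = (\<Sum>e\<in>{e \<in> {..<n} \<times> {..<n} \<rightarrow>\<^sub>E {..d}. sum e ({..<n} \<times> {..<n}) = d}.
                 c e * (\<Prod>ij\<in>{..<n} \<times> {..<n}. (T $$ ij) ^ e ij)))"

definition line :: "('k::field, 'k) module" where
  "line = \<lparr>carrier = UNIV, mult = (*), one = 1, zero = 0, add = (+), smult = (*)\<rparr>"

text \<open>Representations need not be finite-dimensional, so the matrix coefficients are taken with
  respect to all vectors and all linear functionals. The coefficients have to be polynomial
  as functions on the group; over a finite field the polynomial is not unique.\<close>

definition homogeneous_polynomial_rep ::
  "nat \<Rightarrow> nat \<Rightarrow> ('k::field, 'k mat, 'w) repr \<Rightarrow> bool" where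
  "homogeneous_polynomial_rep d n = (\<lambda>(W, \<rho>).
     \<forall>l\<in>module_hom class_ring W line. \<forall>x\<in>carrier W.
       homogeneous_polynomial_on_GL d n (\<lambda>T. l (\<rho> T x)))"

definition Rep_GL :: "nat \<Rightarrow> nat \<Rightarrow> (('k::field, 'k mat, 'w) repr, 'w \<Rightarrow> 'w) category" where
  "Rep_GL d n = rep_cat (GL n) (homogeneous_polynomial_rep d n)"


section \<open>The functors of the diagram\<close>

text \<open>A category of sets has to live over a fixed type. Finite sets are taken over \<^typ>\<open>nat + 'a\<close>,
  which contains every \<open>[n]\<close>; finite-dimensional vector spaces have their points in the following
  type, which contains the coordinate spaces, the function spaces and an arbitrary type \<open>'x\<close>.\<close>

datatype ('k, 'a, 'x) point =
  Vec (the_vec: "'k vec") | Fn (the_fn: "(nat + 'a) \<Rightarrow> 'k") | Elt 'x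

text \<open>\<open>relabel p q M\<close> transports the structure of \<open>M\<close> along an injection \<open>p\<close> with left inverse \<open>q\<close>.\<close>

definition relabel :: "('v \<Rightarrow> 'u) \<Rightarrow> ('u \<Rightarrow> 'v) \<Rightarrow> ('k, 'v) module \<Rightarrow> ('k, 'u) module" where
  "relabel p q M = \<lparr>
     carrier = p ` carrier M,
     mult = \<lambda>x y. p (q x \<otimes>\<^bsub>M\<^esub> q y), one = p \<one>\<^bsub>M\<^esub>,
     zero = p \<zero>\<^bsub>M\<^esub>, add = \<lambda>x y. p (q x \<oplus>\<^bsub>M\<^esub> q y),
     smult = \<lambda>c x. p (c \<odot>\<^bsub>M\<^esub> q x)\<rparr>"

definition coord_space :: "nat \<Rightarrow> ('k::field, ('k, 'a, 'x) point) module" where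
  "coord_space n = relabel Vec the_vec (module_vec TYPE('k) n)"

definition mat_map :: "nat \<Rightarrow> 'k::field mat \<Rightarrow> ('k, 'a, 'x) point \<Rightarrow> ('k, 'a, 'x) point" where
  "mat_map n T = (\<lambda>x\<in>carrier (coord_space n). Vec (T *\<^sub>v the_vec x))"

definition fun_space :: "(nat + 'a) set \<Rightarrow> ('k::field, ('k, 'a, 'x) point) module" where
  "fun_space A = relabel Fn the_fn (ring.func_space class_ring A)"

definition fun_map ::
  "(nat + 'a) set \<Rightarrow> (nat + 'a) set \<Rightarrow> (nat + 'a \<Rightarrow> nat + 'a) \<Rightarrow>
   ('k::field, 'a, 'x) point \<Rightarrow> ('k, 'a, 'x) point" where
  "fun_map A B i = (\<lambda>x\<in>carrier (fun_space A).
     Fn (\<lambda>b\<in>B. if b \<in> i ` A then the_fn x (inv_into A i b) else 0))"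

definition fun_fctr ::
  "nat \<Rightarrow> ((nat + 'a) set, nat + 'a \<Rightarrow> nat + 'a, ('k::field, ('k, 'a, 'x) point) module,
           ('k, ('k, 'a, 'x) point) tensor \<Rightarrow> ('k, ('k, 'a, 'x) point) tensor) fctr" where
  "fun_fctr d = \<lparr>
     fob = fun_space,
     fmor = \<lambda>A B i. tensor_map d (fun_space A) (fun_space B) (fun_map A B i)\<rparr>"

type_synonym ('k, 'a, 'x, 'w) spf = "('k, ('k, 'a, 'x) point, 'w) Gamma_fctr"
type_synonym ('k, 'a, 'x, 'w) spf_trans = "('k, ('k, 'a, 'x) point) module \<Rightarrow> 'w \<Rightarrow> 'w"

definition Res_FI ::
  "nat \<Rightarrow> (('k::field, 'a, 'x, 'w) spf, ('k, 'a, 'x, 'w) spf_trans,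
           ('k, nat + 'a, 'w) FI_fctr, (nat + 'a) set \<Rightarrow> 'w \<Rightarrow> 'w) fctr" where
  "Res_FI d = \<lparr>
     fob = \<lambda>F. fctr_comp F (fun_fctr d),
     fmor = \<lambda>F G \<eta>. \<lambda>A\<in>Obj FI. \<eta> (fun_space A)\<rparr>"

definition ev_GL ::
  "nat \<Rightarrow> nat \<Rightarrow> (('k::field, 'a, 'x, 'w) spf, ('k, 'a, 'x, 'w) spf_trans,
                  ('k, 'k mat, 'w) repr, 'w \<Rightarrow> 'w) fctr" where
  "ev_GL d n = \<lparr>
     fob = \<lambda>F. (fob F (coord_space n),
                 \<lambda>T. fmor F (coord_space n) (coord_space n)
                        (tensor_map d (coord_space n) (coord_space n) (mat_map n T))),
     fmor = \<lambda>F G \<eta>. \<eta> (coord_space n)\<rparr>"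

definition std_set :: "nat \<Rightarrow> (nat + 'a) set" where
  "std_set n = Inl ` {1..n}"

definition ev_FI ::
  "nat \<Rightarrow> (('k::field, nat + 'a, 'w) FI_fctr, (nat + 'a) set \<Rightarrow> 'w \<Rightarrow> 'w,
           ('k, nat \<Rightarrow> nat, 'w) repr, 'w \<Rightarrow> 'w) fctr" where
  "ev_FI n = \<lparr>
     fob = \<lambda>V. (fob V (std_set n),
                 \<lambda>\<sigma>. fmor V (std_set n) (std_set n) (\<lambda>a\<in>std_set n. Inl (\<sigma> (projl a)))),
     fmor = \<lambda>V W \<eta>. \<eta> (std_set n)\<rparr>"

text \<open>Matrix indices start at 0, the symmetric group acts on \<open>{1..n}\<close>.\<close>

definition perm_mat :: "nat \<Rightarrow> (nat \<Rightarrow> nat) \<Rightarrow> 'k::field mat" where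
  "perm_mat n \<sigma> = mat n n (\<lambda>(i, j). if Suc i = \<sigma> (Suc j) then 1 else 0)"

definition Res_S ::
  "nat \<Rightarrow> (('k::field, 'k mat, 'w) repr, 'w \<Rightarrow> 'w, ('k, nat \<Rightarrow> nat, 'w) repr, 'w \<Rightarrow> 'w) fctr" where
  "Res_S n = \<lparr>
     fob = \<lambda>(W, \<rho>). (W, \<lambda>\<sigma>. \<rho> (perm_mat n \<sigma>)),
     fmor = \<lambda>R S f. f\<rparr>"

end

theory Submission
  imports Defs
begin

text \<open>
  Let \<open>\<phi> : K\<^sup>n \<rightarrow> \<F>[n]\<close> be the linear isomorphism that reads a column vector as a function on \<open>[n]\<close>.
  It turns the action of a permutation matrix into the action of the permutation, viewed as an
  injection \<open>[n] \<rightarrow> [n]\<close> (\<open>std_iso_equivariant\<close>). Hence its tensor power is an isomorphism in \<open>\<Gamma>\<^sup>d\<close> that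
  is compatible with both actions of the symmetric group, and applying a strict polynomial functor \<open>F\<close>
  gives an isomorphism of representations \<open>F(K\<^sup>n) \<rightarrow> F(\<F>[n])\<close>. It is natural in \<open>F\<close>, because a morphism of
  functors commutes with the images of every morphism of \<open>\<Gamma>\<^sup>d\<close>. This is the natural isomorphism of the
  square (\<open>restriction_square\<close>).

  That the four arrows are functors is mostly formal: evaluating a functor to vector spaces at an
  object with a group action gives a representation, and functors compose. The exception is that
  \<open>F(K\<^sup>n)\<close> is a homogeneous polynomial representation of degree \<open>d\<close>. Write \<open>T = \<Sum> t\<^bsub>ij\<^esub> E\<^bsub>ij\<^esub>\<close> with the matrix
  units. Then the tensor power of \<open>T\<close> is the sum, over all words \<open>w\<close> of \<open>d\<close> index pairs, of the operators
  \<open>E\<^bsub>w 1\<^esub> \<otimes> \<dots> \<otimes> E\<^bsub>w d\<^esub>\<close> with coefficients \<open>t\<^bsub>w 1\<^esub> \<dots> t\<^bsub>w d\<^esub>\<close>. A single operator of this kind is in general not equivariant, so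
  \<open>F\<close> cannot be applied to it. But the coefficient depends only on how often each pair occurs in \<open>w\<close>, and
  the sum of the operators over all words with given multiplicities is equivariant
  (\<open>monomial_map_equivariant\<close>). So the tensor power of \<open>T\<close> is a combination of fixed morphisms of \<open>\<Gamma>\<^sup>d\<close>
  with the monomials of degree \<open>d\<close> as coefficients (\<open>tensor_map_expand\<close>), and the linearity of \<open>F\<close> on morphisms
  makes the matrix coefficients of \<open>F(K\<^sup>n)\<close> polynomial (\<open>ev_GL_homogeneous_polynomial\<close>).

  Tensor powers are quotients of free spaces on tuples. All maps between them below are induced by linear
  maps of the free spaces that respect the relations (\<open>descend\<close>), and identities between them are
  checked on single tuples modulo the relations (\<open>descend_eqI\<close>).
\<close>

section \<open>Functor categories\<close>

lemma category_intro:
  assumes "\<And>A. A \<in> Obj C \<Longrightarrow> Idm C A \<in> Mor C A A"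
    and "\<And>A B D f g. A \<in> Obj C \<Longrightarrow> B \<in> Obj C \<Longrightarrow> D \<in> Obj C \<Longrightarrow> f \<in> Mor C A B \<Longrightarrow> g \<in> Mor C B D \<Longrightarrow>
      Cmp C A B D g f \<in> Mor C A D"
    and "\<And>A B f. A \<in> Obj C \<Longrightarrow> B \<in> Obj C \<Longrightarrow> f \<in> Mor C A B \<Longrightarrow> Cmp C A A B f (Idm C A) = f"
    and "\<And>A B f. A \<in> Obj C \<Longrightarrow> B \<in> Obj C \<Longrightarrow> f \<in> Mor C A B \<Longrightarrow> Cmp C A B B (Idm C B) f = f"
    and "\<And>A B D E f g h. A \<in> Obj C \<Longrightarrow> B \<in> Obj C \<Longrightarrow> D \<in> Obj C \<Longrightarrow> E \<in> Obj C \<Longrightarrow>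
      f \<in> Mor C A B \<Longrightarrow> g \<in> Mor C B D \<Longrightarrow> h \<in> Mor C D E \<Longrightarrow>
      Cmp C A D E h (Cmp C A B D g f) = Cmp C A B E (Cmp C B D E h g) f"
  shows "is_category C"
  using assms unfolding is_category_def by simp

lemma category_id:
  "is_category C \<Longrightarrow> A \<in> Obj C \<Longrightarrow> Idm C A \<in> Mor C A A"
  by (simp add: is_category_def)

lemma category_comp:
  "is_category C \<Longrightarrow> A \<in> Obj C \<Longrightarrow> B \<in> Obj C \<Longrightarrow> D \<in> Obj C \<Longrightarrow> f \<in> Mor C A B \<Longrightarrow> g \<in> Mor C B D \<Longrightarrow>
    Cmp C A B D g f \<in> Mor C A D"
  by (simp add: is_category_def)

lemma category_id_right:
  "is_category C \<Longrightarrow> A \<in> Obj C \<Longrightarrow> B \<in> Obj C \<Longrightarrow> f \<in> Mor C A B \<Longrightarrow> Cmp C A A B f (Idm C A) = f"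
  by (simp add: is_category_def)

lemma category_id_left:
  "is_category C \<Longrightarrow> A \<in> Obj C \<Longrightarrow> B \<in> Obj C \<Longrightarrow> f \<in> Mor C A B \<Longrightarrow> Cmp C A B B (Idm C B) f = f"
  by (simp add: is_category_def)

lemma category_assoc:
  "is_category C \<Longrightarrow> A \<in> Obj C \<Longrightarrow> B \<in> Obj C \<Longrightarrow> D \<in> Obj C \<Longrightarrow> E \<in> Obj C \<Longrightarrow>
    f \<in> Mor C A B \<Longrightarrow> g \<in> Mor C B D \<Longrightarrow> h \<in> Mor C D E \<Longrightarrow>
    Cmp C A D E h (Cmp C A B D g f) = Cmp C A B E (Cmp C B D E h g) f"
  by (simp add: is_category_def)

lemma functor_intro:
  assumes "is_category C" "is_category D"
    and "\<And>A. A \<in> Obj C \<Longrightarrow> fob F A \<in> Obj D"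
    and "\<And>A B f. A \<in> Obj C \<Longrightarrow> B \<in> Obj C \<Longrightarrow> f \<in> Mor C A B \<Longrightarrow> fmor F A B f \<in> Mor D (fob F A) (fob F B)"
    and "\<And>A. A \<in> Obj C \<Longrightarrow> fmor F A A (Idm C A) = Idm D (fob F A)"
    and "\<And>A B E f g. A \<in> Obj C \<Longrightarrow> B \<in> Obj C \<Longrightarrow> E \<in> Obj C \<Longrightarrow> f \<in> Mor C A B \<Longrightarrow> g \<in> Mor C B E \<Longrightarrow>
        fmor F A E (Cmp C A B E g f)
          = Cmp D (fob F A) (fob F B) (fob F E) (fmor F B E g) (fmor F A B f)"
  shows "is_functor C D F"
  using assms unfolding is_functor_def by simp

lemma functor_categories:
  assumes "is_functor C D F" shows "is_category C" "is_category D"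
  using assms by (simp_all add: is_functor_def)

lemma functor_obj:
  "is_functor C D F \<Longrightarrow> A \<in> Obj C \<Longrightarrow> fob F A \<in> Obj D"
  by (simp add: is_functor_def)

lemma functor_mor:
  "is_functor C D F \<Longrightarrow> A \<in> Obj C \<Longrightarrow> B \<in> Obj C \<Longrightarrow> f \<in> Mor C A B \<Longrightarrow>
    fmor F A B f \<in> Mor D (fob F A) (fob F B)"
  by (simp add: is_functor_def)

lemma functor_id:
  "is_functor C D F \<Longrightarrow> A \<in> Obj C \<Longrightarrow> fmor F A A (Idm C A) = Idm D (fob F A)"
  by (simp add: is_functor_def)

lemma functor_cmp:
  "is_functor C D F \<Longrightarrow> A \<in> Obj C \<Longrightarrow> B \<in> Obj C \<Longrightarrow> E \<in> Obj C \<Longrightarrow> f \<in> Mor C A B \<Longrightarrow> g \<in> Mor C B E \<Longrightarrow>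
    fmor F A E (Cmp C A B E g f) = Cmp D (fob F A) (fob F B) (fob F E) (fmor F B E g) (fmor F A B f)"
  by (simp add: is_functor_def)

lemma functor_fctr_comp:
  assumes F: "is_functor C D F" and G: "is_functor D E G"
  shows "is_functor C E (fctr_comp G F)"
  by (rule functor_intro)
     (simp_all add: fctr_comp_def functor_categories[OF F] functor_categories[OF G]
       functor_obj[OF F] functor_obj[OF G] functor_mor[OF F] functor_mor[OF G]
       functor_id[OF F] functor_id[OF G] functor_cmp[OF F] functor_cmp[OF G])

lemma functor_preserves_iso:
  assumes F: "is_functor C D F" and A: "A \<in> Obj C" and B: "B \<in> Obj C" and f: "is_iso C A B f"
  shows "is_iso D (fob F A) (fob F B) (fmor F A B f)"
proof -
  from f obtain g where fm: "f \<in> Mor C A B" and g: "g \<in> Mor C B A" "Cmp C A B A g f = Idm C A"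
    "Cmp C B A B f g = Idm C B" unfolding is_iso_def by auto
  have "Cmp D (fob F A) (fob F B) (fob F A) (fmor F B A g) (fmor F A B f) = Idm D (fob F A)"
    "Cmp D (fob F B) (fob F A) (fob F B) (fmor F A B f) (fmor F B A g) = Idm D (fob F B)"
    using functor_cmp[OF F A B A fm g(1)] functor_cmp[OF F B A B g(1) fm] g
      functor_id[OF F A] functor_id[OF F B] by simp_all
  then show ?thesis unfolding is_iso_def using functor_mor[OF F A B fm] functor_mor[OF F B A g(1)]
    by blast
qed

lemma nat_trans_mor: "nat_trans C D F G \<eta> \<Longrightarrow> A \<in> Obj C \<Longrightarrow> \<eta> A \<in> Mor D (fob F A) (fob G A)"
  by (simp add: nat_trans_def)

lemma nat_trans_square:
  "nat_trans C D F G \<eta> \<Longrightarrow> A \<in> Obj C \<Longrightarrow> B \<in> Obj C \<Longrightarrow> f \<in> Mor C A B \<Longrightarrow>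
    Cmp D (fob F A) (fob F B) (fob G B) (\<eta> B) (fmor F A B f)
          = Cmp D (fob F A) (fob G A) (fob G B) (fmor G A B f) (\<eta> A)"
  by (simp add: nat_trans_def)

lemma nat_trans_id:
  assumes F: "is_functor C D F"
  shows "nat_trans C D F F (\<lambda>A\<in>Obj C. Idm D (fob F A))"
proof -
  note D = functor_categories(2)[OF F]
  show ?thesis
    unfolding nat_trans_def
    by (auto simp: functor_obj[OF F] functor_mor[OF F] category_id[OF D]
        category_id_left[OF D] category_id_right[OF D])
qed

text \<open>Pasting the naturality squares of \<open>\<eta>\<close> and \<open>\<epsilon>\<close> side by side.\<close>

lemma nat_trans_comp:
  assumes F: "is_functor C D F" and G: "is_functor C D G" and H: "is_functor C D H"
    and e: "nat_trans C D F G \<eta>" and z: "nat_trans C D G H \<epsilon>"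
  shows "nat_trans C D F H (\<lambda>A\<in>Obj C. Cmp D (fob F A) (fob G A) (fob H A) (\<epsilon> A) (\<eta> A))"
proof -
  note D = functor_categories(2)[OF F]
  note obs = functor_obj[OF F] functor_obj[OF G] functor_obj[OF H]
  { fix A B f assume A: "A \<in> Obj C" and B: "B \<in> Obj C" and f: "f \<in> Mor C A B"
    note mors = functor_mor[OF F A B f] functor_mor[OF G A B f] functor_mor[OF H A B f]
      nat_trans_mor[OF e A] nat_trans_mor[OF e B] nat_trans_mor[OF z A] nat_trans_mor[OF z B]
    have "Cmp D (fob F A) (fob F B) (fob H B) (Cmp D (fob F B) (fob G B) (fob H B) (\<epsilon> B) (\<eta> B)) (fmor F A B f)
      = Cmp D (fob F A) (fob G B) (fob H B) (\<epsilon> B) (Cmp D (fob F A) (fob F B) (fob G B) (\<eta> B) (fmor F A B f))"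
      by (rule category_assoc[OF D, symmetric]) (simp_all add: A B obs mors)
    also have "\<dots> = Cmp D (fob F A) (fob G B) (fob H B) (\<epsilon> B) (Cmp D (fob F A) (fob G A) (fob G B) (fmor G A B f) (\<eta> A))"
      by (simp add: nat_trans_square[OF e A B f])
    also have "\<dots> = Cmp D (fob F A) (fob G A) (fob H B) (Cmp D (fob G A) (fob G B) (fob H B) (\<epsilon> B) (fmor G A B f)) (\<eta> A)"
      by (rule category_assoc[OF D]) (simp_all add: A B obs mors)
    also have "\<dots> = Cmp D (fob F A) (fob G A) (fob H B) (Cmp D (fob G A) (fob H A) (fob H B) (fmor H A B f) (\<epsilon> A)) (\<eta> A)"
      by (simp add: nat_trans_square[OF z A B f])
    also have "\<dots> = Cmp D (fob F A) (fob H A) (fob H B) (fmor H A B f) (Cmp D (fob F A) (fob G A) (fob H A) (\<epsilon> A) (\<eta> A))"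
      by (rule category_assoc[OF D, symmetric]) (simp_all add: A B obs mors)
    finally have "Cmp D (fob F A) (fob F B) (fob H B) (Cmp D (fob F B) (fob G B) (fob H B) (\<epsilon> B) (\<eta> B)) (fmor F A B f)
      = Cmp D (fob F A) (fob H A) (fob H B) (fmor H A B f) (Cmp D (fob F A) (fob G A) (fob H A) (\<epsilon> A) (\<eta> A))" .
  }
  moreover have "Cmp D (fob F A) (fob G A) (fob H A) (\<epsilon> A) (\<eta> A) \<in> Mor D (fob F A) (fob H A)"
    if "A \<in> Obj C" for A
    by (rule category_comp[OF D]) (simp_all add: that obs nat_trans_mor[OF e] nat_trans_mor[OF z])
  ultimately show ?thesis unfolding nat_trans_def by simp
qed

lemma functor_cat_simps:
  "F \<in> Obj (functor_cat C D P) \<longleftrightarrow> is_functor C D F \<and> P F"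
  "\<eta> \<in> Mor (functor_cat C D P) F G \<longleftrightarrow> nat_trans C D F G \<eta>"
  "Idm (functor_cat C D P) F = (\<lambda>A\<in>Obj C. Idm D (fob F A))"
  "Cmp (functor_cat C D P) F G H \<epsilon> \<eta> = (\<lambda>A\<in>Obj C. Cmp D (fob F A) (fob G A) (fob H A) (\<epsilon> A) (\<eta> A))"
  by (simp_all add: functor_cat_def)

text \<open>A transformation is fixed to be \<^const>\<open>undefined\<close> off the objects of \<open>C\<close>, so the category laws hold
  as equations of functions as soon as they hold at each object, where they are those of \<open>D\<close>.\<close>

lemma functor_cat_is_category: "is_category (functor_cat C D P)"
proof (rule category_intro, goal_cases)
  case (1 F) then show ?case by (auto simp: functor_cat_def nat_trans_id)
next
  case (2 F G H \<eta> \<epsilon>) then show ?case by (auto simp: functor_cat_def intro: nat_trans_comp)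
next
  case (3 F G \<eta>)
  then have F: "is_functor C D F" and G: "is_functor C D G" and e: "nat_trans C D F G \<eta>"
    by (auto simp: functor_cat_def)
  have "Cmp D (fob F A) (fob F A) (fob G A) (\<eta> A) (Idm D (fob F A)) = \<eta> A" if "A \<in> Obj C" for A
    using category_id_right[OF functor_categories(2)[OF F]] functor_obj[OF F that] functor_obj[OF G that]
      nat_trans_mor[OF e that] by simp
  moreover have "\<eta> \<in> extensional (Obj C)" using e by (simp add: nat_trans_def)
  ultimately show ?case by (auto simp: functor_cat_def intro: extensionalityI)
next
  case (4 F G \<eta>)
  then have F: "is_functor C D F" and G: "is_functor C D G" and e: "nat_trans C D F G \<eta>"
    by (auto simp: functor_cat_def)
  have "Cmp D (fob F A) (fob G A) (fob G A) (Idm D (fob G A)) (\<eta> A) = \<eta> A" if "A \<in> Obj C" for A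
    using category_id_left[OF functor_categories(2)[OF F]] functor_obj[OF F that] functor_obj[OF G that]
      nat_trans_mor[OF e that] by simp
  moreover have "\<eta> \<in> extensional (Obj C)" using e by (simp add: nat_trans_def)
  ultimately show ?case by (auto simp: functor_cat_def intro: extensionalityI)
next
  case (5 F G H I \<eta> \<epsilon> \<zeta>)
  then have F: "is_functor C D F" and G: "is_functor C D G" and H: "is_functor C D H" and I: "is_functor C D I"
    and e: "nat_trans C D F G \<eta>" and z: "nat_trans C D G H \<epsilon>" and y: "nat_trans C D H I \<zeta>"
    by (auto simp: functor_cat_def)
  have "Cmp D (fob F A) (fob H A) (fob I A) (\<zeta> A) (Cmp D (fob F A) (fob G A) (fob H A) (\<epsilon> A) (\<eta> A))
    = Cmp D (fob F A) (fob G A) (fob I A) (Cmp D (fob G A) (fob H A) (fob I A) (\<zeta> A) (\<epsilon> A)) (\<eta> A)"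
    if A: "A \<in> Obj C" for A
    by (rule category_assoc[OF functor_categories(2)[OF F]])
       (simp_all add: A functor_obj[OF F] functor_obj[OF G] functor_obj[OF H] functor_obj[OF I]
          nat_trans_mor[OF e] nat_trans_mor[OF z] nat_trans_mor[OF y])
  then show ?case by (auto simp: functor_cat_def intro: restrict_ext)
qed


section \<open>Vector spaces, representations and finite sets\<close>

lemma lin_maps_iff:
  fixes V :: "('k::field, 'v) module"
  shows "f \<in> lin_maps V W \<longleftrightarrow> f \<in> extensional (carrier V) \<and> (\<forall>x\<in>carrier V. f x \<in> carrier W) \<and>
    (\<forall>x\<in>carrier V. \<forall>y\<in>carrier V. f (x \<oplus>\<^bsub>V\<^esub> y) = f x \<oplus>\<^bsub>W\<^esub> f y) \<and>
    (\<forall>c. \<forall>x\<in>carrier V. f (c \<odot>\<^bsub>V\<^esub> x) = c \<odot>\<^bsub>W\<^esub> f x)"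
  unfolding lin_maps_def LinearCombinations.module_hom_def by auto

lemma module_hom_iff:
  fixes V :: "('k::field, 'v) module"
  shows "f \<in> module_hom class_ring V W \<longleftrightarrow> (\<forall>x\<in>carrier V. f x \<in> carrier W) \<and>
    (\<forall>x\<in>carrier V. \<forall>y\<in>carrier V. f (x \<oplus>\<^bsub>V\<^esub> y) = f x \<oplus>\<^bsub>W\<^esub> f y) \<and>
    (\<forall>c. \<forall>x\<in>carrier V. f (c \<odot>\<^bsub>V\<^esub> x) = c \<odot>\<^bsub>W\<^esub> f x)"
  unfolding LinearCombinations.module_hom_def by auto

lemma vectorspace_closed:
  assumes "vectorspace class_ring (V :: ('k::field, 'v) module)"
  shows "x \<in> carrier V \<Longrightarrow> y \<in> carrier V \<Longrightarrow> x \<oplus>\<^bsub>V\<^esub> y \<in> carrier V"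
    and "x \<in> carrier V \<Longrightarrow> c \<odot>\<^bsub>V\<^esub> x \<in> carrier V"
    and "\<zero>\<^bsub>V\<^esub> \<in> carrier V"
    and "x \<in> carrier V \<Longrightarrow> 0 \<odot>\<^bsub>V\<^esub> x = \<zero>\<^bsub>V\<^esub>"
proof -
  interpret vectorspace class_ring V by fact
  show "x \<in> carrier V \<Longrightarrow> y \<in> carrier V \<Longrightarrow> x \<oplus>\<^bsub>V\<^esub> y \<in> carrier V" by simp
  show "x \<in> carrier V \<Longrightarrow> c \<odot>\<^bsub>V\<^esub> x \<in> carrier V" by simp
  show "\<zero>\<^bsub>V\<^esub> \<in> carrier V" by simp
  show "x \<in> carrier V \<Longrightarrow> 0 \<odot>\<^bsub>V\<^esub> x = \<zero>\<^bsub>V\<^esub>" using lmult_0[of x] by simp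
qed

lemma lin_maps_id:
  "vectorspace class_ring (V :: ('k::field, 'v) module) \<Longrightarrow> (\<lambda>x\<in>carrier V. x) \<in> lin_maps V V"
  by (simp add: lin_maps_iff vectorspace_closed)

lemma lin_maps_compose:
  "\<lbrakk>vectorspace class_ring (U :: ('k::field, 'u) module); f \<in> lin_maps U V; g \<in> lin_maps V W\<rbrakk> \<Longrightarrow>
    compose (carrier U) g f \<in> lin_maps U W"
  by (simp add: lin_maps_iff compose_def vectorspace_closed)

lemma compose_restrict_id:
  assumes "f \<in> extensional A" "\<And>x. x \<in> A \<Longrightarrow> f x \<in> B"
  shows "compose A f (\<lambda>x\<in>A. x) = f" "compose A (\<lambda>x\<in>B. x) f = f"
  using assms by (auto simp: compose_def fun_eq_iff extensional_def)

lemma compose_assoc_on: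
  assumes "\<And>x. x \<in> A \<Longrightarrow> f x \<in> B"
  shows "compose A h (compose A g f) = compose A (compose B h g) f"
  using assms by (auto simp: compose_def)

lemma Vect_simps:
  "W \<in> Obj Vect \<longleftrightarrow> vectorspace class_ring W" "Mor Vect V W = lin_maps V W"
  "Idm Vect W = (\<lambda>x\<in>carrier W. x)" "Cmp Vect U V W g f = compose (carrier U) g f"
  by (simp_all add: Vect_def)

lemma rep_cat_simps:
  "R \<in> Obj (rep_cat G P) \<longleftrightarrow> is_rep G R \<and> P R"
  "Mor (rep_cat G P) R S = {f \<in> lin_maps (fst R) (fst S). \<forall>g\<in>carrier G. \<forall>x\<in>carrier (fst R). f (snd R g x) = snd S g (f x)}"
  "Idm (rep_cat G P) R = (\<lambda>x\<in>carrier (fst R). x)"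
  "Cmp (rep_cat G P) R S T g f = compose (carrier (fst R)) g f"
  by (simp_all add: rep_cat_def)

lemma rep_cat_is_category: "is_category (rep_cat G (P :: ('k::field, 'g, 'w) repr \<Rightarrow> bool))"
proof -
  have vs: "vectorspace class_ring (fst R)" if "R \<in> Obj (rep_cat G P)" for R
    using that by (auto simp: rep_cat_def is_rep_def)
  have act: "snd R g x \<in> carrier (fst R)" if "R \<in> Obj (rep_cat G P)" "g \<in> carrier G" "x \<in> carrier (fst R)" for R g x
    using that by (auto simp: rep_cat_def is_rep_def lin_maps_iff)
  show ?thesis
  proof (rule category_intro, goal_cases)
    case (1 R) then show ?case using vs[of R] act[of R]
      by (auto simp: rep_cat_def lin_maps_id)
  next
    case (2 R S T f g)
    then have "compose (carrier (fst R)) g f \<in> lin_maps (fst R) (fst T)"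
      using lin_maps_compose[OF vs[of R]] by (auto simp: rep_cat_def)
    moreover have "compose (carrier (fst R)) g f (snd R a x) = snd T a (compose (carrier (fst R)) g f x)"
      if "a \<in> carrier G" "x \<in> carrier (fst R)" for a x
      using that 2(4,5) act[OF 2(1) that] by (auto simp: rep_cat_def compose_def lin_maps_iff)
    ultimately show ?case by (simp add: rep_cat_def)
  next
    case (3 R S f) then show ?case by (auto simp: rep_cat_def lin_maps_iff intro: compose_restrict_id)
  next
    case (4 R S f) then show ?case by (auto simp: rep_cat_def lin_maps_iff intro: compose_restrict_id)
  next
    case (5 R S T U f g h) then show ?case by (auto simp: rep_cat_def lin_maps_iff intro: compose_assoc_on)
  qed
qed

lemma FI_simps:
  "A \<in> Obj FI \<longleftrightarrow> finite A" "i \<in> Mor FI A B \<longleftrightarrow> i \<in> A \<rightarrow>\<^sub>E B \<and> inj_on i A" "Idm FI A = (\<lambda>a\<in>A. a)"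
  "Cmp FI A B D j i = compose A j i"
  by (simp_all add: FI_def)

lemma FI_is_category: "is_category FI"
proof (rule category_intro, goal_cases)
  case (2 A B D f g)
  then have "f \<in> A \<rightarrow> B" "g \<in> B \<rightarrow> D" "inj_on f A" "inj_on g B" by (auto simp: FI_def)
  then have "compose A g f \<in> A \<rightarrow> D" "inj_on (compose A g f) A"
    by (auto simp: compose_def inj_on_def Pi_iff)
  then show ?case by (auto simp: FI_def PiE_def compose_def)
qed (auto simp: FI_def inj_on_def intro!: compose_restrict_id compose_assoc_on simp: PiE_def)


section \<open>Free vector spaces\<close>

text \<open>Scalar multiplication of formal linear combinations, in the form that \<^const>\<open>free_space\<close> uses.\<close>

abbreviation scl :: "'k::field \<Rightarrow> ('t \<Rightarrow>\<^sub>0 'k) \<Rightarrow> ('t \<Rightarrow>\<^sub>0 'k)" where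
  "scl c \<equiv> Poly_Mapping.map ((*) c)"

lemma lookup_scl: "Poly_Mapping.lookup (scl c p) x = c * Poly_Mapping.lookup p x"
  by (simp add: Poly_Mapping.map.rep_eq when_def)

lemma scl_simps [simp]:
  "scl c (p + q) = scl c p + scl c q"
  "scl c (p - q) = scl c p - scl c q"
  "scl (a + b) p = scl a p + scl b p"
  "scl a (scl b p) = scl (a * b) p"
  "scl 1 p = p" "scl 0 p = 0" "scl c 0 = 0" "scl (- 1) p = - p"
  "scl c (Poly_Mapping.single x a) = Poly_Mapping.single x (c * a)"
  by (rule poly_mapping_eqI, simp add: lookup_scl lookup_add lookup_minus lookup_single
      when_def algebra_simps)+

lemma scl_sum: "scl c (\<Sum>i\<in>I. p i) = (\<Sum>i\<in>I. scl c (p i))"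
  by (induction I rule: infinite_finite_induct) simp_all

lemma keys_scl: "Poly_Mapping.keys (scl c p) \<subseteq> Poly_Mapping.keys p"
  by (auto simp: in_keys_iff lookup_scl)

definition free_linear :: "(('s \<Rightarrow>\<^sub>0 'k::field) \<Rightarrow> ('t \<Rightarrow>\<^sub>0 'k)) \<Rightarrow> bool" where
  "free_linear L \<longleftrightarrow> (\<forall>p q. L (p + q) = L p + L q) \<and> (\<forall>c p. L (scl c p) = scl c (L p))"

lemma free_linear_simps:
  assumes "free_linear L"
  shows "L (p + q) = L p + L q" "L (scl c p) = scl c (L p)" "L 0 = 0" "L (p - q) = L p - L q"
    "L (Poly_Mapping.single x a) = scl a (L (Poly_Mapping.single x 1))"
    "L (\<Sum>i\<in>I. f i) = (\<Sum>i\<in>I. L (f i))"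
proof -
  show a: "L (p + q) = L p + L q" for p q using assms by (simp add: free_linear_def)
  show s: "L (scl c p) = scl c (L p)" for c p using assms by (simp add: free_linear_def)
  show z: "L 0 = 0" using s[of 0 0] by simp
  have m: "L (- p) = - L p" for p using s[of "-1" p] by simp
  show "L (p - q) = L p - L q" using a[of p "- q"] m[of q] by simp
  show "L (Poly_Mapping.single x a) = scl a (L (Poly_Mapping.single x 1))"
    using s[of a "Poly_Mapping.single x 1"] by simp
  show "L (\<Sum>i\<in>I. f i) = (\<Sum>i\<in>I. L (f i))"
    by (induction I rule: infinite_finite_induct) (simp_all add: a z)
qed

lemma free_linear_comp: "free_linear L \<Longrightarrow> free_linear M \<Longrightarrow> free_linear (\<lambda>p. M (L p))"
  by (simp add: free_linear_def)

lemma free_linear_add: "free_linear L \<Longrightarrow> free_linear M \<Longrightarrow> free_linear (\<lambda>p. L p + M p)"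
  by (simp add: free_linear_def)

lemma free_linear_scl: "free_linear L \<Longrightarrow> free_linear (\<lambda>p. scl c (L p))"
  by (simp add: free_linear_def mult.commute)

lemma free_map_superset:
  assumes "finite S" "Poly_Mapping.keys p \<subseteq> S"
  shows "free_map g p = (\<Sum>x\<in>S. Poly_Mapping.single (g x) (Poly_Mapping.lookup p x))"
  unfolding free_map_def using assms
  by (intro sum.mono_neutral_left) (auto simp: in_keys_iff)

lemma free_map_linear: "free_linear (free_map g)"
  unfolding free_linear_def
proof (intro conjI allI)
  fix p q :: "'a \<Rightarrow>\<^sub>0 'b" and c :: 'b
  let ?S = "Poly_Mapping.keys p \<union> Poly_Mapping.keys q"
  have S: "finite ?S" "Poly_Mapping.keys p \<subseteq> ?S" "Poly_Mapping.keys q \<subseteq> ?S"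
    "Poly_Mapping.keys (p + q) \<subseteq> ?S" using Poly_Mapping.keys_add[of p q] by auto
  show "free_map g (p + q) = free_map g p + free_map g q"
    by (simp add: free_map_superset[OF S(1,2)] free_map_superset[OF S(1,3)] free_map_superset[OF S(1,4)]
        lookup_add single_add sum.distrib)
  show "free_map g (scl c p) = scl c (free_map g p)"
    by (simp add: free_map_superset[OF _ keys_scl] free_map_def[of g p] lookup_scl scl_sum)
qed

lemma free_map_single [simp]: "free_map g (Poly_Mapping.single x c) = Poly_Mapping.single (g x) c"
  by (simp add: free_map_def)

text \<open>A linear map is determined by its values on the basis. This turns every statement about formal
  combinations of tuples into one about single tuples.\<close>

lemma free_linear_eq_sum:
  assumes "free_linear L"
  shows "L p = (\<Sum>x\<in>Poly_Mapping.keys p. scl (Poly_Mapping.lookup p x) (L (Poly_Mapping.single x 1)))"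
proof -
  have "p = (\<Sum>x\<in>Poly_Mapping.keys p. Poly_Mapping.single x (Poly_Mapping.lookup p x))"
    by (rule poly_mapping_eqI) (auto simp: lookup_sum lookup_single when_def in_keys_iff)
  then have "L p = L (\<Sum>x\<in>Poly_Mapping.keys p. Poly_Mapping.single x (Poly_Mapping.lookup p x))" by simp
  also have "\<dots> = (\<Sum>x\<in>Poly_Mapping.keys p. L (Poly_Mapping.single x (Poly_Mapping.lookup p x)))"
    by (rule free_linear_simps(6)[OF assms])
  also have "\<dots> = (\<Sum>x\<in>Poly_Mapping.keys p. scl (Poly_Mapping.lookup p x) (L (Poly_Mapping.single x 1)))"
    by (rule sum.cong[OF refl], rule free_linear_simps(5)[OF assms])
  finally show ?thesis .
qed

lemma free_linear_in_subspace:
  assumes L: "free_linear L" and p: "Poly_Mapping.keys p \<subseteq> X"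
    and X: "\<And>x. x \<in> X \<Longrightarrow> L (Poly_Mapping.single x 1) \<in> N"
    and N: "0 \<in> N" "\<And>p q. p \<in> N \<Longrightarrow> q \<in> N \<Longrightarrow> p + q \<in> N" "\<And>c p. p \<in> N \<Longrightarrow> scl c p \<in> N"
  shows "L p \<in> N"
proof -
  have "(\<Sum>x\<in>S. scl (Poly_Mapping.lookup p x) (L (Poly_Mapping.single x 1))) \<in> N"
    if "finite S" "S \<subseteq> X" for S
    using that by (induction S rule: finite_induct) (auto intro: N X)
  from this[OF _ p] show ?thesis by (subst free_linear_eq_sum[OF L]) simp
qed

lemma free_linear_cong:
  assumes "free_linear L" "free_linear M" "Poly_Mapping.keys p \<subseteq> X"
    and "\<And>x. x \<in> X \<Longrightarrow> L (Poly_Mapping.single x 1) = M (Poly_Mapping.single x 1)"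
  shows "L p = M p"
  unfolding free_linear_eq_sum[OF assms(1), of p] free_linear_eq_sum[OF assms(2), of p]
  by (rule sum.cong[OF refl]) (use assms(3,4) in \<open>simp add: subset_iff\<close>)

lemma free_space_simps [simp]:
  "carrier (free_space X) = {p. Poly_Mapping.keys p \<subseteq> X}"
  "zero (free_space X) = 0" "add (free_space X) = (+)" "smult (free_space X) = scl"
  by (simp_all add: free_space_def)

lemma keys_add_subset: "Poly_Mapping.keys p \<subseteq> X \<Longrightarrow> Poly_Mapping.keys q \<subseteq> X \<Longrightarrow> Poly_Mapping.keys (p + q) \<subseteq> X"
  using Poly_Mapping.keys_add[of p q] by blast

lemma keys_diff_subset: "Poly_Mapping.keys p \<subseteq> X \<Longrightarrow> Poly_Mapping.keys q \<subseteq> X \<Longrightarrow> Poly_Mapping.keys (p - q) \<subseteq> X"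
  using keys_diff[of p q] by blast

lemma keys_scl_subset: "Poly_Mapping.keys p \<subseteq> X \<Longrightarrow> Poly_Mapping.keys (scl c p) \<subseteq> X"
  using keys_scl[of c p] by blast

lemma keys_single_subset: "x \<in> X \<Longrightarrow> Poly_Mapping.keys (Poly_Mapping.single x c) \<subseteq> X"
  by simp

lemma free_space_vectorspace: "vectorspace class_ring (free_space X :: ('k::field, 't \<Rightarrow>\<^sub>0 'k) module)"
proof (rule vs_criteria)
  show "field (class_ring :: 'k ring)" by (rule class_field)
  show "\<forall>v\<in>carrier (free_space X). \<exists>neg_v\<in>carrier (free_space X :: ('k, 't \<Rightarrow>\<^sub>0 'k) module). v \<oplus>\<^bsub>free_space X\<^esub> neg_v = \<zero>\<^bsub>free_space X\<^esub>"
  proof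
    fix v :: "'t \<Rightarrow>\<^sub>0 'k" assume "v \<in> carrier (free_space X)"
    then show "\<exists>neg_v\<in>carrier (free_space X). v \<oplus>\<^bsub>free_space X\<^esub> neg_v = \<zero>\<^bsub>free_space X\<^esub>"
      by (intro bexI[of _ "- v"]) simp_all
  qed
qed (simp_all add: add.assoc add.commute keys_add_subset keys_scl_subset)


section \<open>Tensor powers\<close>

abbreviation tuple_space :: "nat \<Rightarrow> ('k::field, 'v) module \<Rightarrow> ((nat \<Rightarrow> 'v) \<Rightarrow>\<^sub>0 'k) set" where
  "tuple_space d V \<equiv> {p. Poly_Mapping.keys p \<subseteq> tuples d V}"

lemma tuples_upd: "x \<in> tuples d V \<Longrightarrow> k \<in> {1..d} \<Longrightarrow> u \<in> carrier V \<Longrightarrow> x(k := u) \<in> tuples d V"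
  by (auto simp: tuples_def PiE_def extensional_def)

lemma tuples_mem: "x \<in> tuples d V \<Longrightarrow> k \<in> {1..d} \<Longrightarrow> x k \<in> carrier V"
  by (auto simp: tuples_def)

lemma multilin_rels_subset:
  assumes "vectorspace class_ring V"
  shows "multilin_rels d V \<subseteq> tuple_space d V"
proof
  have upd: "Poly_Mapping.keys (Poly_Mapping.single (x(k := u)) c) \<subseteq> tuples d V"
    if "x \<in> tuples d V" "k \<in> {1..d}" "u \<in> carrier V" for x k u and c :: 'a
    by (rule keys_single_subset[OF tuples_upd[OF that]])
  fix p assume "p \<in> multilin_rels d V"
  then show "p \<in> tuple_space d V"
    unfolding multilin_rels_def
    by (elim UnE CollectE exE conjE)
       (simp_all only: mem_Collect_eq keys_diff_subset upd vectorspace_closed[OF assms])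
qed

lemma tensor_rels_submodule:
  assumes "vectorspace class_ring V"
  shows "LinearCombinations.submodule class_ring (tensor_rels d V) (free_space (tuples d V))"
proof -
  interpret F: vectorspace class_ring "free_space (tuples d V) :: ('a, (nat \<Rightarrow> 'b) \<Rightarrow>\<^sub>0 'a) module"
    by (rule free_space_vectorspace)
  show ?thesis unfolding tensor_rels_def
    by (rule F.span_is_submodule) (use multilin_rels_subset[OF assms] in simp)
qed

text \<open>The properties of a span, in terms of the type class operations on formal combinations, in which all
  later calculations take place.\<close>

lemma tensor_rels_closed:
  assumes "vectorspace class_ring V"
  shows "0 \<in> tensor_rels d V"
    and "p \<in> tensor_rels d V \<Longrightarrow> q \<in> tensor_rels d V \<Longrightarrow> p + q \<in> tensor_rels d V"
    and "p \<in> tensor_rels d V \<Longrightarrow> scl c p \<in> tensor_rels d V"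
    and "p \<in> tensor_rels d V \<Longrightarrow> q \<in> tensor_rels d V \<Longrightarrow> p - q \<in> tensor_rels d V"
    and "p \<in> tensor_rels d V \<Longrightarrow> p \<in> tuple_space d V"
proof -
  interpret s: LinearCombinations.submodule class_ring "tensor_rels d V" "free_space (tuples d V)"
    by (rule tensor_rels_submodule[OF assms])
  show "0 \<in> tensor_rels d V" using s.zero_closed by simp
  show a: "p \<in> tensor_rels d V \<Longrightarrow> q \<in> tensor_rels d V \<Longrightarrow> p + q \<in> tensor_rels d V" for p q
    using s.m_closed[of p q] by simp
  show c: "p \<in> tensor_rels d V \<Longrightarrow> scl c p \<in> tensor_rels d V" for c p
    using s.smult_closed[of c p] by simp
  show "p \<in> tensor_rels d V \<Longrightarrow> q \<in> tensor_rels d V \<Longrightarrow> p - q \<in> tensor_rels d V"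
    using a[of p "- q"] c[of q "-1"] by simp
  show "p \<in> tensor_rels d V \<Longrightarrow> p \<in> tuple_space d V" using s.subset by auto
qed

lemma tensor_rels_sum:
  assumes "vectorspace class_ring V" and "\<And>i. i \<in> I \<Longrightarrow> p i \<in> tensor_rels d V"
  shows "(\<Sum>i\<in>I. p i) \<in> tensor_rels d V"
  using assms(2) by (induction I rule: infinite_finite_induct) (auto intro: tensor_rels_closed[OF assms(1)])

lemma multilin_rels_in_tensor_rels:
  assumes "vectorspace class_ring V" "p \<in> multilin_rels d V"
  shows "p \<in> tensor_rels d V"
proof -
  interpret F: vectorspace class_ring "free_space (tuples d V) :: ('a, (nat \<Rightarrow> 'b) \<Rightarrow>\<^sub>0 'a) module"
    by (rule free_space_vectorspace)
  have "multilin_rels d V \<subseteq> tensor_rels d V" unfolding tensor_rels_def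
    by (rule F.in_own_span) (use multilin_rels_subset[OF assms(1)] in simp)
  with assms(2) show ?thesis by blast
qed

lemma tensor_rel_add:
  assumes "vectorspace class_ring V" "x \<in> tuples d V" "k \<in> {1..d}" "u \<in> carrier V" "v \<in> carrier V"
  shows "Poly_Mapping.single (x(k := u \<oplus>\<^bsub>V\<^esub> v)) c - Poly_Mapping.single (x(k := u)) c
        - Poly_Mapping.single (x(k := v)) c \<in> tensor_rels d V"
proof -
  have "Poly_Mapping.single (x(k := u \<oplus>\<^bsub>V\<^esub> v)) 1 - Poly_Mapping.single (x(k := u)) 1
        - Poly_Mapping.single (x(k := v)) 1 \<in> tensor_rels d V"
    by (rule multilin_rels_in_tensor_rels[OF assms(1)]) (use assms in \<open>unfold multilin_rels_def, blast\<close>)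
  from tensor_rels_closed(3)[OF assms(1) this, of c] show ?thesis by simp
qed

lemma tensor_rel_smult:
  assumes "vectorspace class_ring V" "x \<in> tuples d V" "k \<in> {1..d}" "u \<in> carrier V"
  shows "Poly_Mapping.single (x(k := a \<odot>\<^bsub>V\<^esub> u)) c - Poly_Mapping.single (x(k := u)) (c * a) \<in> tensor_rels d V"
proof -
  have "Poly_Mapping.single (x(k := a \<odot>\<^bsub>V\<^esub> u)) 1 - Poly_Mapping.single (x(k := u)) a \<in> tensor_rels d V"
    by (rule multilin_rels_in_tensor_rels[OF assms(1)]) (use assms in \<open>unfold multilin_rels_def, blast\<close>)
  from tensor_rels_closed(3)[OF assms(1) this, of c] show ?thesis by simp
qed

definition tclass :: "nat \<Rightarrow> ('k::field, 'v) module \<Rightarrow> ((nat \<Rightarrow> 'v) \<Rightarrow>\<^sub>0 'k) \<Rightarrow> ('k, 'v) tensor" where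
  "tclass d V p = (\<lambda>h. h + p) ` tensor_rels d V"

text \<open>Equality of tensors is congruence of representatives modulo the relations, so computations with
  tensors can be done in the free space, where sums are sums of a type class.\<close>

lemma tclass_eq_iff:
  assumes "vectorspace class_ring V"
  shows "tclass d V p = tclass d V q \<longleftrightarrow> p - q \<in> tensor_rels d V"
proof
  assume eq: "tclass d V p = tclass d V q"
  have "p \<in> tclass d V p" unfolding tclass_def
    using tensor_rels_closed(1)[OF assms] by (intro image_eqI[of _ _ 0]) auto
  then show "p - q \<in> tensor_rels d V" unfolding eq by (auto simp: tclass_def)
next
  assume pq: "p - q \<in> tensor_rels d V"
  show "tclass d V p = tclass d V q"
  proof (intro equalityI subsetI)
    fix z assume "z \<in> tclass d V p"
    then obtain h where h: "h \<in> tensor_rels d V" "z = h + p" by (auto simp: tclass_def)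
    then show "z \<in> tclass d V q" unfolding tclass_def
      using tensor_rels_closed(2)[OF assms h(1) pq] by (intro image_eqI[of _ _ "h + (p - q)"]) simp_all
  next
    fix z assume "z \<in> tclass d V q"
    then obtain h where h: "h \<in> tensor_rels d V" "z = h + q" by (auto simp: tclass_def)
    then show "z \<in> tclass d V p" unfolding tclass_def
      using tensor_rels_closed(4)[OF assms h(1) pq] by (intro image_eqI[of _ _ "h - (p - q)"]) simp_all
  qed
qed

lemma carrier_tensor_power: "carrier (tensor_power d V) = tclass d V ` tuple_space d V"
  by (auto simp: tensor_power_def quotient_space_def A_RCOSETS_def' a_r_coset_def' tclass_def)

lemma tclass_add:
  assumes "vectorspace class_ring V"
  shows "tclass d V p \<oplus>\<^bsub>tensor_power d V\<^esub> tclass d V q = tclass d V (p + q)"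
proof (intro equalityI subsetI)
  fix z assume "z \<in> tclass d V p \<oplus>\<^bsub>tensor_power d V\<^esub> tclass d V q"
  then obtain h k where hk: "h \<in> tensor_rels d V" "k \<in> tensor_rels d V" "z = (h + p) + (k + q)"
    by (auto simp: tensor_power_def quotient_space_def set_add_def' tclass_def)
  then show "z \<in> tclass d V (p + q)" unfolding tclass_def
    using tensor_rels_closed(2)[OF assms hk(1,2)] by (intro image_eqI[of _ _ "h + k"]) (simp_all add: algebra_simps)
next
  fix z assume "z \<in> tclass d V (p + q)"
  then obtain h where h: "h \<in> tensor_rels d V" "z = (h + p) + (0 + q)" by (auto simp: tclass_def add.assoc)
  then have "\<exists>a\<in>tclass d V p. \<exists>b\<in>tclass d V q. z = a + b"
    using tensor_rels_closed(1)[OF assms, of d] unfolding tclass_def by blast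
  then show "z \<in> tclass d V p \<oplus>\<^bsub>tensor_power d V\<^esub> tclass d V q"
    by (simp add: tensor_power_def quotient_space_def set_add_def')
qed

text \<open>Scalar multiplication and induced maps are defined by mapping a whole coset and then adding the relations.
  The image of a coset need not be a coset (scaling by zero collapses it), but it lies in one and is
  nonempty, and this makes the result the class of any of its points.\<close>

lemma set_add_tclass:
  assumes V: "vectorspace class_ring V" and S: "S \<subseteq> tclass d V p" "S \<noteq> {}"
  shows "set_add (free_space (tuples d V)) (tensor_rels d V) S = tclass d V p"
proof (intro equalityI subsetI)
  fix z assume "z \<in> set_add (free_space (tuples d V)) (tensor_rels d V) S"
  then obtain h s where "h \<in> tensor_rels d V" "s \<in> S" "z = h + s" by (auto simp: set_add_def')
  then obtain k where hk: "h \<in> tensor_rels d V" "k \<in> tensor_rels d V" "z = h + (k + p)"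
    using S(1) unfolding tclass_def by blast
  then show "z \<in> tclass d V p" unfolding tclass_def
    using tensor_rels_closed(2)[OF V hk(1,2)] by (intro image_eqI[of _ _ "h + k"]) (simp_all add: algebra_simps)
next
  fix z assume "z \<in> tclass d V p"
  then obtain h where h: "h \<in> tensor_rels d V" "z = h + p" by (auto simp: tclass_def)
  from S obtain k where k: "k \<in> tensor_rels d V" "k + p \<in> S" by (auto simp: tclass_def)
  have "h - k \<in> tensor_rels d V" by (rule tensor_rels_closed(4)[OF V h(1) k(1)])
  moreover have "z = (h - k) + (k + p)" using h by simp
  ultimately have "\<exists>x\<in>tensor_rels d V. \<exists>s\<in>S. z = x + s" using k(2) by blast
  then show "z \<in> set_add (free_space (tuples d V)) (tensor_rels d V) S"
    by (simp add: set_add_def')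
qed

lemma tclass_nonempty:
  assumes "vectorspace class_ring V" shows "tclass d V p \<noteq> {}"
  using tensor_rels_closed(1)[OF assms] by (auto simp: tclass_def)

lemma tclass_smult:
  assumes "vectorspace class_ring V"
  shows "c \<odot>\<^bsub>tensor_power d V\<^esub> tclass d V p = tclass d V (scl c p)"
proof -
  have "scl c ` tclass d V p \<subseteq> tclass d V (scl c p)"
    by (auto simp: tclass_def intro!: imageI tensor_rels_closed[OF assms])
  moreover have "scl c ` tclass d V p \<noteq> {}" using tclass_nonempty[OF assms] by simp
  ultimately show ?thesis using set_add_tclass[OF assms]
    by (simp add: tensor_power_def quotient_space_def)
qed


section \<open>Maps of tensor powers\<close>

definition tensorial ::
  "nat \<Rightarrow> ('k::field, 'v) module \<Rightarrow> ('k, 'w) module \<Rightarrow> (((nat \<Rightarrow> 'v) \<Rightarrow>\<^sub>0 'k) \<Rightarrow> ((nat \<Rightarrow> 'w) \<Rightarrow>\<^sub>0 'k)) \<Rightarrow> bool" where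
  "tensorial d V W L \<longleftrightarrow> free_linear L \<and>
     (\<forall>x\<in>tuples d V. L (Poly_Mapping.single x 1) \<in> tuple_space d W) \<and>
     (\<forall>h\<in>tensor_rels d V. L h \<in> tensor_rels d W)"

text \<open>The induced map. In this generality, rather than only for maps of tuples as in
  \<^const>\<open>tensor_induced\<close>, it covers sums and scalar multiples of induced maps.\<close>

definition descend ::
  "nat \<Rightarrow> ('k::field, 'v) module \<Rightarrow> ('k, 'w) module \<Rightarrow> (((nat \<Rightarrow> 'v) \<Rightarrow>\<^sub>0 'k) \<Rightarrow> ((nat \<Rightarrow> 'w) \<Rightarrow>\<^sub>0 'k)) \<Rightarrow>
   ('k, 'v) tensor \<Rightarrow> ('k, 'w) tensor" where
  "descend d V W L = (\<lambda>X\<in>carrier (tensor_power d V).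
     set_add (free_space (tuples d W)) (tensor_rels d W) (L ` X))"

lemma tensor_induced_descend: "tensor_induced d V W g = descend d V W (free_map g)"
  by (simp add: tensor_induced_def descend_def)

lemma tensorial_carrier:
  assumes "tensorial d V W L" "p \<in> tuple_space d V"
  shows "L p \<in> tuple_space d W"
proof (rule free_linear_in_subspace[of _ _ "tuples d V"])
  show "free_linear L" "Poly_Mapping.keys p \<subseteq> tuples d V" using assms by (auto simp: tensorial_def)
qed (use assms in \<open>simp_all add: tensorial_def keys_add_subset keys_scl_subset\<close>)

text \<open>The elements that \<open>L\<close> carries to relations form a subspace, so testing the generators is enough.\<close>

lemma tensor_rels_linear_image:
  assumes V: "vectorspace class_ring V" and W: "vectorspace class_ring W" and L: "free_linear L"
    and gen: "\<And>h. h \<in> multilin_rels d V \<Longrightarrow> L h \<in> tensor_rels d W" and h: "h \<in> tensor_rels d V"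
  shows "L h \<in> tensor_rels d W"
proof -
  let ?N = "{h \<in> tuple_space d V. L h \<in> tensor_rels d W}"
  interpret F: vectorspace class_ring "free_space (tuples d V) :: ('a, (nat \<Rightarrow> 'b) \<Rightarrow>\<^sub>0 'a) module"
    by (rule free_space_vectorspace)
  have "tensor_rels d V \<subseteq> ?N" unfolding tensor_rels_def[of d V]
  proof (rule F.span_is_subset)
    show "multilin_rels d V \<subseteq> ?N" using multilin_rels_subset[OF V] gen by blast
    show "LinearCombinations.submodule class_ring ?N (free_space (tuples d V))"
      by (rule LinearCombinations.submodule.intro[OF F.module_axioms])
         (simp_all add: free_linear_simps(1,2,3)[OF L] tensor_rels_closed[OF W]
           keys_add_subset keys_scl_subset Collect_mono_iff)
  qed
  with h show ?thesis by blast
qed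

lemma descend_tclass:
  assumes V: "vectorspace class_ring V" and W: "vectorspace class_ring W" and L: "tensorial d V W L"
    and p: "p \<in> tuple_space d V"
  shows "descend d V W L (tclass d V p) = tclass d W (L p)"
proof -
  have "L ` tclass d V p \<subseteq> tclass d W (L p)"
    using L by (auto simp: tclass_def tensorial_def free_linear_simps(1))
  moreover have "L ` tclass d V p \<noteq> {}" using tclass_nonempty[OF V] by simp
  ultimately show ?thesis using p
    by (simp add: descend_def carrier_tensor_power set_add_tclass[OF W])
qed

lemma descend_in_lin_maps:
  assumes V: "vectorspace class_ring V" and W: "vectorspace class_ring W" and L: "tensorial d V W L"
  shows "descend d V W L \<in> lin_maps (tensor_power d V) (tensor_power d W)"
proof -
  have lin: "free_linear L" using L by (simp add: tensorial_def)
  have "descend d V W L \<in> extensional (carrier (tensor_power d V))" by (simp add: descend_def)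
  moreover have "descend d V W L X \<in> carrier (tensor_power d W)" if "X \<in> carrier (tensor_power d V)" for X
    using that tensorial_carrier[OF L] by (auto simp: carrier_tensor_power descend_tclass[OF V W L])
  moreover have "descend d V W L (X \<oplus>\<^bsub>tensor_power d V\<^esub> Y) = descend d V W L X \<oplus>\<^bsub>tensor_power d W\<^esub> descend d V W L Y"
    if X: "X \<in> carrier (tensor_power d V)" and Y: "Y \<in> carrier (tensor_power d V)" for X Y
  proof -
    obtain p q where "p \<in> tuple_space d V" "X = tclass d V p" "q \<in> tuple_space d V" "Y = tclass d V q"
      using X Y by (auto simp: carrier_tensor_power)
    then show ?thesis
      by (simp add: descend_tclass[OF V W L] tclass_add[OF V] tclass_add[OF W] keys_add_subset
          free_linear_simps(1)[OF lin])
  qed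
  moreover have "descend d V W L (c \<odot>\<^bsub>tensor_power d V\<^esub> X) = c \<odot>\<^bsub>tensor_power d W\<^esub> descend d V W L X"
    if X: "X \<in> carrier (tensor_power d V)" for c X
  proof -
    obtain p where "p \<in> tuple_space d V" "X = tclass d V p" using X by (auto simp: carrier_tensor_power)
    then show ?thesis
      by (simp add: descend_tclass[OF V W L] tclass_smult[OF V] tclass_smult[OF W] keys_scl_subset
          free_linear_simps(2)[OF lin])
  qed
  ultimately show ?thesis unfolding lin_maps_iff by blast
qed

text \<open>Pure tensors generate the tensor power, so two induced maps agree if they agree on tuples modulo
  the relations.\<close>

lemma descend_eqI:
  assumes V: "vectorspace class_ring V" and W: "vectorspace class_ring W"
    and L: "tensorial d V W L" and M: "tensorial d V W M"
    and eq: "\<And>x. x \<in> tuples d V \<Longrightarrow> L (Poly_Mapping.single x 1) - M (Poly_Mapping.single x 1) \<in> tensor_rels d W"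
  shows "descend d V W L = descend d V W M"
proof (rule extensionalityI)
  show "descend d V W L \<in> extensional (carrier (tensor_power d V))"
    "descend d V W M \<in> extensional (carrier (tensor_power d V))" by (simp_all add: descend_def)
  fix X assume "X \<in> carrier (tensor_power d V)"
  then obtain p where p: "p \<in> tuple_space d V" and X: "X = tclass d V p" by (auto simp: carrier_tensor_power)
  have lin: "free_linear (\<lambda>p. L p - M p)"
    using L M by (simp add: tensorial_def free_linear_def)
  have "L p - M p \<in> tensor_rels d W"
    by (rule free_linear_in_subspace[OF lin, of p "tuples d V"])
       (use p eq in \<open>auto intro: tensor_rels_closed[OF W]\<close>)
  then show "descend d V W L X = descend d V W M X"
    using p by (simp add: X descend_tclass[OF V W L] descend_tclass[OF V W M] tclass_eq_iff[OF W])
qed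

lemma tensorial_comp:
  assumes "tensorial d U V L" "tensorial d V W M"
  shows "tensorial d U W (\<lambda>p. M (L p))"
  unfolding tensorial_def
proof (intro conjI ballI)
  show "free_linear (\<lambda>p. M (L p))"
    using assms by (intro free_linear_comp[of L M]) (simp_all add: tensorial_def)
  show "M (L (Poly_Mapping.single x 1)) \<in> tuple_space d W" if "x \<in> tuples d U" for x
    using assms that by (intro tensorial_carrier[OF assms(2)]) (simp add: tensorial_def)
  show "M (L h) \<in> tensor_rels d W" if "h \<in> tensor_rels d U" for h
    using assms that by (simp add: tensorial_def)
qed

lemma tensorial_scl:
  assumes "vectorspace class_ring W" "tensorial d V W L"
  shows "tensorial d V W (\<lambda>p. scl c (L p))"
  using assms unfolding tensorial_def
  by (simp add: free_linear_scl tensor_rels_closed keys_scl_subset)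

lemma tensorial_add:
  assumes "vectorspace class_ring W" "tensorial d V W L" "tensorial d V W M"
  shows "tensorial d V W (\<lambda>p. L p + M p)"
  using assms unfolding tensorial_def
  by (simp add: free_linear_add tensor_rels_closed keys_add_subset)

lemma tensorial_zero:
  assumes "vectorspace class_ring W" shows "tensorial d V W (\<lambda>p. 0)"
  using assms by (simp add: tensorial_def free_linear_def tensor_rels_closed)

lemma tensorial_sum:
  assumes W: "vectorspace class_ring W" and "\<And>i. i \<in> I \<Longrightarrow> tensorial d V W (L i)"
  shows "tensorial d V W (\<lambda>p. \<Sum>i\<in>I. L i p)"
  using assms(2)
  by (induction I rule: infinite_finite_induct) (auto intro: tensorial_zero tensorial_add W)

lemma descend_compose:
  assumes U: "vectorspace class_ring U" and V: "vectorspace class_ring V" and W: "vectorspace class_ring W"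
    and L: "tensorial d U V L" and M: "tensorial d V W M"
  shows "compose (carrier (tensor_power d U)) (descend d V W M) (descend d U V L)
    = descend d U W (\<lambda>p. M (L p))"
proof (rule extensionalityI)
  fix X assume "X \<in> carrier (tensor_power d U)"
  then obtain p where p: "p \<in> tuple_space d U" and X: "X = tclass d U p" by (auto simp: carrier_tensor_power)
  then show "compose (carrier (tensor_power d U)) (descend d V W M) (descend d U V L) X
    = descend d U W (\<lambda>p. M (L p)) X"
    using tensorial_carrier[OF L p]
    by (simp add: compose_def descend_tclass[OF U V L] descend_tclass[OF V W M]
        descend_tclass[OF U W tensorial_comp[OF L M]] carrier_tensor_power)
qed (simp_all add: descend_def)

lemma hom_add_descend:
  assumes V: "vectorspace class_ring V" and W: "vectorspace class_ring W"
    and L: "tensorial d V W L" and M: "tensorial d V W M"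
  shows "hom_add (tensor_power d V) (tensor_power d W) (descend d V W L) (descend d V W M)
    = descend d V W (\<lambda>p. L p + M p)"
proof (rule extensionalityI)
  fix X assume "X \<in> carrier (tensor_power d V)"
  then obtain p where p: "p \<in> tuple_space d V" and X: "X = tclass d V p" by (auto simp: carrier_tensor_power)
  then show "hom_add (tensor_power d V) (tensor_power d W) (descend d V W L) (descend d V W M) X
    = descend d V W (\<lambda>p. L p + M p) X"
    by (simp add: hom_add_def descend_tclass[OF V W L] descend_tclass[OF V W M]
        descend_tclass[OF V W tensorial_add[OF W L M]] carrier_tensor_power tclass_add[OF W])
qed (simp_all add: descend_def hom_add_def)

lemma hom_smult_descend:
  assumes V: "vectorspace class_ring V" and W: "vectorspace class_ring W" and L: "tensorial d V W L"
  shows "hom_smult (tensor_power d V) (tensor_power d W) c (descend d V W L) = descend d V W (\<lambda>p. scl c (L p))"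
proof (rule extensionalityI)
  fix X assume "X \<in> carrier (tensor_power d V)"
  then obtain p where p: "p \<in> tuple_space d V" and X: "X = tclass d V p" by (auto simp: carrier_tensor_power)
  then show "hom_smult (tensor_power d V) (tensor_power d W) c (descend d V W L) X
    = descend d V W (\<lambda>p. scl c (L p)) X"
    by (simp add: hom_smult_def descend_tclass[OF V W L]
        descend_tclass[OF V W tensorial_scl[OF W L]] carrier_tensor_power tclass_smult[OF W])
qed (simp_all add: descend_def hom_smult_def)

definition slotwise :: "nat \<Rightarrow> (nat \<Rightarrow> 'v \<Rightarrow> 'w) \<Rightarrow> (nat \<Rightarrow> nat) \<Rightarrow> (nat \<Rightarrow> 'v) \<Rightarrow> (nat \<Rightarrow> 'w)" where
  "slotwise d f \<pi> x = (\<lambda>k\<in>{1..d}. f k (x (\<pi> k)))"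

lemma slotwise_tuples:
  fixes V :: "('k::field, 'v) module" and W :: "('k, 'w) module"
  assumes "\<And>k. k \<in> {1..d} \<Longrightarrow> f k \<in> module_hom class_ring V W" "\<pi> permutes {1..d}" "x \<in> tuples d V"
  shows "slotwise d f \<pi> x \<in> tuples d W"
proof -
  have "f k (x (\<pi> k)) \<in> carrier W" if "k \<in> {1..d}" for k
  proof -
    have "\<pi> k \<in> {1..d}" using permutes_in_image[OF assms(2)] that by blast
    then show ?thesis using assms(1)[OF that] tuples_mem[OF assms(3), of "\<pi> k"] by (simp add: module_hom_iff)
  qed
  then show ?thesis by (simp add: slotwise_def tuples_def)
qed

lemma slotwise_upd:
  assumes "\<pi> permutes {1..d}" "k \<in> {1..d}"
  shows "slotwise d f \<pi> (x(\<pi> k := u)) = (slotwise d f \<pi> x)(k := f k u)"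
  using assms permutes_inj[OF assms(1)] by (auto simp: slotwise_def fun_eq_iff inj_eq)

text \<open>Slot \<open>j\<close> of the new tuple depends only on slot \<open>\<pi> j\<close> of the old one, and linearly. Hence a
  relation that concerns slot \<open>\<pi> j\<close> becomes a relation of the same kind in slot \<open>j\<close>. Tensor powers of
  linear maps, tensor products of different maps, and permutations of the factors are all of this form.\<close>

lemma tensorial_slotwise:
  assumes V: "vectorspace class_ring (V :: ('k::field, 'v) module)" and W: "vectorspace class_ring (W :: ('k, 'w) module)"
    and f: "\<And>k. k \<in> {1..d} \<Longrightarrow> f k \<in> module_hom class_ring V W" and \<pi>: "\<pi> permutes {1..d}"
  shows "tensorial d V W (free_map (slotwise d f \<pi>) :: ((nat \<Rightarrow> 'v) \<Rightarrow>\<^sub>0 'k) \<Rightarrow> _)"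
  unfolding tensorial_def
proof (intro conjI ballI)
  let ?g = "slotwise d f \<pi>"
  show lin: "free_linear (free_map ?g :: ((nat \<Rightarrow> 'v) \<Rightarrow>\<^sub>0 'k) \<Rightarrow> _)" by (rule free_map_linear)
  show "free_map ?g (Poly_Mapping.single x 1) \<in> tuple_space d W" if "x \<in> tuples d V" for x
    using slotwise_tuples[of d f V W \<pi> x, OF f \<pi> that] by simp
  fix h :: "(nat \<Rightarrow> 'v) \<Rightarrow>\<^sub>0 'k" assume h: "h \<in> tensor_rels d V"
  show "free_map ?g h \<in> tensor_rels d W"
  proof (rule tensor_rels_linear_image[OF V W lin _ h])
    fix h :: "(nat \<Rightarrow> 'v) \<Rightarrow>\<^sub>0 'k" assume "h \<in> multilin_rels d V"
    then consider
      (add) x k u v where "h = Poly_Mapping.single (x(k := u \<oplus>\<^bsub>V\<^esub> v)) 1 - Poly_Mapping.single (x(k := u)) 1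
        - Poly_Mapping.single (x(k := v)) 1" "x \<in> tuples d V" "k \<in> {1..d}" "u \<in> carrier V" "v \<in> carrier V"
      | (smult) x k u c where "h = Poly_Mapping.single (x(k := c \<odot>\<^bsub>V\<^esub> u)) 1 - Poly_Mapping.single (x(k := u)) c"
         "x \<in> tuples d V" "k \<in> {1..d}" "u \<in> carrier V"
      unfolding multilin_rels_def by blast
    then show "free_map ?g h \<in> tensor_rels d W"
    proof cases
      case add
      obtain j where j: "j \<in> {1..d}" "k = \<pi> j"
        using permutes_image[OF \<pi>] add(3) by blast
      have fj: "f j (u \<oplus>\<^bsub>V\<^esub> v) = f j u \<oplus>\<^bsub>W\<^esub> f j v" "f j u \<in> carrier W" "f j v \<in> carrier W"
        using f[OF j(1)] add(4,5) by (simp_all add: module_hom_iff)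
      have "free_map ?g h = Poly_Mapping.single ((?g x)(j := f j u \<oplus>\<^bsub>W\<^esub> f j v)) 1
         - Poly_Mapping.single ((?g x)(j := f j u)) 1 - Poly_Mapping.single ((?g x)(j := f j v)) 1"
        unfolding add(1) free_linear_simps(4)[OF lin] free_map_single j(2) slotwise_upd[OF \<pi> j(1)] fj(1) ..
      then show ?thesis
        using tensor_rel_add[OF W slotwise_tuples[of d f V W \<pi> x, OF f \<pi> add(2)] j(1) fj(2,3), of 1] by simp
    next
      case smult
      obtain j where j: "j \<in> {1..d}" "k = \<pi> j"
        using permutes_image[OF \<pi>] smult(3) by blast
      have fj: "f j (c \<odot>\<^bsub>V\<^esub> u) = c \<odot>\<^bsub>W\<^esub> f j u" "f j u \<in> carrier W"
        using f[OF j(1)] smult(4) by (simp_all add: module_hom_iff)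
      have "free_map ?g h = Poly_Mapping.single ((?g x)(j := c \<odot>\<^bsub>W\<^esub> f j u)) 1
         - Poly_Mapping.single ((?g x)(j := f j u)) c"
        unfolding smult(1) free_linear_simps(4)[OF lin] free_map_single j(2) slotwise_upd[OF \<pi> j(1)] fj(1) ..
      then show ?thesis
        using tensor_rel_smult[OF W slotwise_tuples[of d f V W \<pi> x, OF f \<pi> smult(2)] j(1) fj(2), of c 1] by simp
    qed
  qed
qed


section \<open>The category of equivariant maps of tensor powers\<close>

abbreviation slot_perm :: "nat \<Rightarrow> (nat \<Rightarrow> nat) \<Rightarrow> (nat \<Rightarrow> 'v) \<Rightarrow> (nat \<Rightarrow> 'v)" where
  "slot_perm d \<pi> \<equiv> slotwise d (\<lambda>_ v. v) (inv' \<pi>)"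

text \<open>The action of the symmetric group is the slotwise map with identities in the slots; the inverse is
  there because \<open>\<pi>\<close> moves the factor in slot \<open>k\<close> to slot \<open>\<pi> k\<close>.\<close>

lemma tensor_perm_descend: "tensor_perm d V \<pi> = descend d V V (free_map (slot_perm d \<pi>))"
  unfolding tensor_perm_def tensor_induced_descend slotwise_def ..

lemma tensorial_slot_perm:
  assumes "vectorspace class_ring (V :: ('k::field, 'v) module)" "\<pi> permutes {1..d}"
  shows "tensorial d V V (free_map (slot_perm d \<pi>) :: ((nat \<Rightarrow> 'v) \<Rightarrow>\<^sub>0 'k) \<Rightarrow> _)"
  by (rule tensorial_slotwise[OF assms(1,1) _ permutes_inv[OF assms(2)]]) (simp add: module_hom_iff)

lemma Gamma_simps:
  "V \<in> Obj (Gamma d) \<longleftrightarrow> vectorspace class_ring V \<and> vectorspace.fin_dim class_ring V"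
  "Mor (Gamma d) V W = {f \<in> lin_maps (tensor_power d V) (tensor_power d W).
     \<forall>\<pi>. \<pi> permutes {1..d} \<longrightarrow> (\<forall>X\<in>carrier (tensor_power d V). f (tensor_perm d V \<pi> X) = tensor_perm d W \<pi> (f X))}"
  "Idm (Gamma d) V = (\<lambda>X\<in>carrier (tensor_power d V). X)"
  "Cmp (Gamma d) U V W g f = compose (carrier (tensor_power d U)) g f"
  by (simp_all add: Gamma_def sym_group_def)

lemma tensor_power_closed:
  assumes "vectorspace class_ring V"
  shows "X \<in> carrier (tensor_power d V) \<Longrightarrow> Y \<in> carrier (tensor_power d V) \<Longrightarrow>
      X \<oplus>\<^bsub>tensor_power d V\<^esub> Y \<in> carrier (tensor_power d V)"
    and "X \<in> carrier (tensor_power d V) \<Longrightarrow> c \<odot>\<^bsub>tensor_power d V\<^esub> X \<in> carrier (tensor_power d V)"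
    and "X \<in> carrier (tensor_power d V) \<Longrightarrow> \<pi> permutes {1..d} \<Longrightarrow> tensor_perm d V \<pi> X \<in> carrier (tensor_power d V)"
proof -
  show "X \<in> carrier (tensor_power d V) \<Longrightarrow> Y \<in> carrier (tensor_power d V) \<Longrightarrow>
      X \<oplus>\<^bsub>tensor_power d V\<^esub> Y \<in> carrier (tensor_power d V)"
    by (auto simp: carrier_tensor_power tclass_add[OF assms] keys_add_subset)
  show "X \<in> carrier (tensor_power d V) \<Longrightarrow> c \<odot>\<^bsub>tensor_power d V\<^esub> X \<in> carrier (tensor_power d V)"
    by (auto simp: carrier_tensor_power tclass_smult[OF assms] keys_scl_subset)
  show "tensor_perm d V \<pi> X \<in> carrier (tensor_power d V)"
    if "X \<in> carrier (tensor_power d V)" "\<pi> permutes {1..d}"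
    using descend_in_lin_maps[OF assms assms tensorial_slot_perm[OF assms that(2)]] that(1)
    by (simp add: tensor_perm_descend lin_maps_iff)
qed

lemma Gamma_is_category: "is_category (Gamma d :: (('k::field, 'v) module, _) category)"
proof (rule category_intro, goal_cases)
  case (1 V) then show ?case
    by (auto simp: Gamma_simps lin_maps_iff tensor_power_closed)
next
  case (2 U V W f g) then show ?case
    by (auto simp: Gamma_simps lin_maps_iff compose_def tensor_power_closed)
next
  case (3 U V f) then show ?case by (auto simp: Gamma_simps lin_maps_iff intro!: compose_restrict_id)
next
  case (4 U V f) then show ?case by (auto simp: Gamma_simps lin_maps_iff intro!: compose_restrict_id)
next
  case (5 U V W X f g h) then show ?case by (auto simp: Gamma_simps lin_maps_iff intro!: compose_assoc_on)
qed

text \<open>Equivariance, too, has to be tested on single tuples only. It is asked for in the free space and not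
  just modulo the relations, since it always arises from a permutation of the tuples.\<close>

lemma descend_in_Gamma:
  assumes V: "vectorspace class_ring V" and W: "vectorspace class_ring W" and L: "tensorial d V W L"
    and eq: "\<And>\<pi> x. \<pi> permutes {1..d} \<Longrightarrow> x \<in> tuples d V \<Longrightarrow>
      L (Poly_Mapping.single (slot_perm d \<pi> x) 1) = free_map (slot_perm d \<pi>) (L (Poly_Mapping.single x 1))"
  shows "descend d V W L \<in> Mor (Gamma d) V W"
  unfolding Gamma_simps
proof (intro CollectI conjI allI impI ballI)
  show "descend d V W L \<in> lin_maps (tensor_power d V) (tensor_power d W)" by (rule descend_in_lin_maps[OF V W L])
  fix \<pi> X assume \<pi>: "\<pi> permutes {1..d}" and "X \<in> carrier (tensor_power d V)"
  then obtain p where p: "p \<in> tuple_space d V" and X: "X = tclass d V p" by (auto simp: carrier_tensor_power)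
  note PV = tensorial_slot_perm[OF V \<pi>] and PW = tensorial_slot_perm[OF W \<pi>]
  have lin: "free_linear L" using L by (simp add: tensorial_def)
  have "L (free_map (slot_perm d \<pi>) p) = free_map (slot_perm d \<pi>) (L p)"
    by (rule free_linear_cong[of _ _ _ "tuples d V"])
       (use p eq[OF \<pi>] in \<open>auto intro: free_linear_comp[OF free_map_linear lin] free_linear_comp[OF lin free_map_linear]\<close>)
  then show "descend d V W L (tensor_perm d V \<pi> X) = tensor_perm d W \<pi> (descend d V W L X)"
    using tensorial_carrier[OF PV p] tensorial_carrier[OF L p]
    by (simp only: X tensor_perm_descend descend_tclass[OF V V PV p] descend_tclass[OF V W L]
        p descend_tclass[OF W W PW])
qed

lemma lin_maps_hom: "f \<in> lin_maps V W \<Longrightarrow> f \<in> module_hom class_ring V W"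
  by (simp add: lin_maps_def)

lemma tensor_map_descend: "tensor_map d V W T = descend d V W (free_map (slotwise d (\<lambda>_. T) id))"
  unfolding tensor_map_def tensor_induced_descend slotwise_def by simp

lemma tensorial_tensor_map:
  assumes "vectorspace class_ring (V :: ('k::field, 'v) module)" "vectorspace class_ring (W :: ('k, 'w) module)"
    "T \<in> lin_maps V W"
  shows "tensorial d V W (free_map (slotwise d (\<lambda>_. T) id) :: ((nat \<Rightarrow> 'v) \<Rightarrow>\<^sub>0 'k) \<Rightarrow> _)"
  by (rule tensorial_slotwise) (simp_all add: assms lin_maps_hom permutes_id)

text \<open>The same map acts in every slot, so it does not matter whether the slots are permuted before or after.\<close>

lemma tensor_map_in_Gamma:
  assumes V: "vectorspace class_ring (V :: ('k::field, 'v) module)" and W: "vectorspace class_ring (W :: ('k, 'v) module)"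
    and T: "T \<in> lin_maps V W"
  shows "tensor_map d V W T \<in> Mor (Gamma d) V W"
  unfolding tensor_map_descend
proof (rule descend_in_Gamma[OF V W tensorial_tensor_map[OF V W T]])
  fix \<pi> :: "nat \<Rightarrow> nat" and x :: "nat \<Rightarrow> 'v" assume \<pi>: "\<pi> permutes {1..d}"
  have "inv' \<pi> k \<in> {1..d}" if "k \<in> {1..d}" for k
    using permutes_in_image[OF permutes_inv[OF \<pi>]] that by blast
  then have "slotwise d (\<lambda>_. T) id (slot_perm d \<pi> x) = slot_perm d \<pi> (slotwise d (\<lambda>_. T) id x)"
    by (auto simp: slotwise_def)
  then show "free_map (slotwise d (\<lambda>_. T) id) (Poly_Mapping.single (slot_perm d \<pi> x) 1)
    = free_map (slot_perm d \<pi>) (free_map (slotwise d (\<lambda>_. T) id) (Poly_Mapping.single x (1::'k)))" by simp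
qed

lemma tensor_map_compose:
  assumes U: "vectorspace class_ring U" and V: "vectorspace class_ring V" and W: "vectorspace class_ring W"
    and S: "S \<in> lin_maps U V" and T: "T \<in> lin_maps V W"
  shows "compose (carrier (tensor_power d U)) (tensor_map d V W T) (tensor_map d U V S)
    = tensor_map d U W (compose (carrier U) T S)"
proof -
  note s = tensorial_tensor_map[OF U V S, of d] and t = tensorial_tensor_map[OF V W T, of d]
  show ?thesis
    unfolding tensor_map_descend descend_compose[OF U V W s t]
  proof (rule descend_eqI[OF U W tensorial_comp[OF s t] tensorial_tensor_map[OF U W lin_maps_compose[OF U S T]]])
    fix x assume x: "x \<in> tuples d U"
    have "slotwise d (\<lambda>_. T) id (slotwise d (\<lambda>_. S) id x) = slotwise d (\<lambda>_. compose (carrier U) T S) id x"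
      using tuples_mem[OF x] by (auto simp: slotwise_def compose_def)
    then show "free_map (slotwise d (\<lambda>_. T) id) (free_map (slotwise d (\<lambda>_. S) id) (Poly_Mapping.single x 1))
      - free_map (slotwise d (\<lambda>_. compose (carrier U) T S) id) (Poly_Mapping.single x 1) \<in> tensor_rels d W"
      by (simp add: tensor_rels_closed(1)[OF W])
  qed
qed

lemma tensor_map_id:
  assumes V: "vectorspace class_ring V"
  shows "tensor_map d V V (\<lambda>x\<in>carrier V. x) = (\<lambda>X\<in>carrier (tensor_power d V). X)"
proof -
  note t = tensorial_tensor_map[OF V V lin_maps_id[OF V], of d]
  have i: "tensorial d V V (\<lambda>p. p)" by (simp add: tensorial_def free_linear_def)
  have "tensor_map d V V (\<lambda>x\<in>carrier V. x) = descend d V V (\<lambda>p. p)"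
    unfolding tensor_map_descend
  proof (rule descend_eqI[OF V V t i])
    fix x assume x: "x \<in> tuples d V"
    have "slotwise d (\<lambda>_. \<lambda>x\<in>carrier V. x) id x = x"
      using tuples_mem[OF x] x by (auto simp: slotwise_def tuples_def PiE_def extensional_def)
    then show "free_map (slotwise d (\<lambda>_. \<lambda>x\<in>carrier V. x) id) (Poly_Mapping.single x 1) - Poly_Mapping.single x 1
      \<in> tensor_rels d V" by (simp add: tensor_rels_closed(1)[OF V])
  qed
  also have "\<dots> = (\<lambda>X\<in>carrier (tensor_power d V). X)"
  proof (rule extensionalityI)
    fix X assume "X \<in> carrier (tensor_power d V)"
    then show "descend d V V (\<lambda>p. p) X = (\<lambda>X\<in>carrier (tensor_power d V). X) X"
      using descend_tclass[OF V V i] by (auto simp: carrier_tensor_power)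
  qed (simp_all add: descend_def)
  finally show ?thesis .
qed


section \<open>Coordinate spaces and function spaces\<close>

lemma relabel_simps [simp]:
  "carrier (relabel p q M) = p ` carrier M" "\<zero>\<^bsub>relabel p q M\<^esub> = p \<zero>\<^bsub>M\<^esub>"
  "x \<oplus>\<^bsub>relabel p q M\<^esub> y = p (q x \<oplus>\<^bsub>M\<^esub> q y)" "c \<odot>\<^bsub>relabel p q M\<^esub> x = p (c \<odot>\<^bsub>M\<^esub> q x)"
  by (simp_all add: relabel_def)

lemma relabel_vectorspace:
  assumes M: "vectorspace class_ring (M :: ('k::field, 'v) module)" and q: "\<And>x. q (p x) = x"
  shows "vectorspace class_ring (relabel p q M)"
proof -
  interpret M: vectorspace class_ring M by fact
  show ?thesis
  proof (rule vs_criteria)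
    show "field (class_ring :: 'k ring)" by (rule class_field)
    show "\<forall>v\<in>carrier (relabel p q M). \<exists>neg_v\<in>carrier (relabel p q M). v \<oplus>\<^bsub>relabel p q M\<^esub> neg_v = \<zero>\<^bsub>relabel p q M\<^esub>"
    proof
      fix v assume "v \<in> carrier (relabel p q M)"
      then obtain x where x: "x \<in> carrier M" "v = p x" by auto
      then show "\<exists>neg_v\<in>carrier (relabel p q M). v \<oplus>\<^bsub>relabel p q M\<^esub> neg_v = \<zero>\<^bsub>relabel p q M\<^esub>"
        by (intro bexI[of _ "p (\<ominus>\<^bsub>M\<^esub> x)"]) (simp_all add: q M.r_neg)
    qed
  qed (auto simp: q M.a_assoc M.a_comm M.a_lcomm M.smult_l_distr[simplified] M.smult_r_distr[simplified]
      M.smult_assoc1[simplified] M.smult_one[simplified] intro!: imageI M.smult_closed)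
qed

text \<open>Finite dimension passes to images; this reduces it to the standard coordinate space for all
  spaces below.\<close>

lemma fin_dim_surj:
  assumes V: "vectorspace class_ring V" and W: "vectorspace class_ring W"
    and T: "T \<in> module_hom class_ring V W" "T ` carrier V = carrier W" and f: "vectorspace.fin_dim class_ring V"
  shows "vectorspace.fin_dim class_ring W"
proof -
  interpret V: vectorspace class_ring V by fact
  interpret W: vectorspace class_ring W by fact
  interpret linear_map class_ring V W T
    by (intro linear_map.intro mod_hom.intro mod_hom_axioms.intro V W T(1) V.module_axioms W.module_axioms)
  show ?thesis by (rule surj_fin_dim[OF f T(2)])
qed

lemma coord_space_simps [simp]:
  "carrier (coord_space n) = Vec ` carrier_vec n"
  "Vec u \<oplus>\<^bsub>coord_space n\<^esub> Vec v = Vec (u + v)" "c \<odot>\<^bsub>coord_space n\<^esub> Vec v = Vec (c \<cdot>\<^sub>v v)"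
  "\<zero>\<^bsub>coord_space n\<^esub> = Vec (0\<^sub>v n)"
  by (simp_all add: coord_space_def module_vec_simps)

lemma coord_space_vectorspace: "vectorspace class_ring (coord_space n)"
  unfolding coord_space_def by (rule relabel_vectorspace[OF vec_vs]) simp

lemma coord_space_obj: "coord_space n \<in> Obj (Gamma d)"
proof -
  have "vectorspace.fin_dim class_ring (coord_space n :: ('a, ('a, 'b, 'c) point) module)"
  proof (rule fin_dim_surj[OF vec_vs coord_space_vectorspace])
    show "Vec \<in> module_hom class_ring (module_vec TYPE('a) n) (coord_space n)"
      by (auto simp: module_hom_iff module_vec_simps)
    show "Vec ` carrier (module_vec TYPE('a) n) = carrier (coord_space n)" by (simp add: module_vec_simps)
    show "vectorspace.fin_dim class_ring (module_vec TYPE('a) n)" by (rule vec_space.fin_dim)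
  qed
  then show ?thesis by (simp add: Gamma_simps coord_space_vectorspace)
qed

lemma fun_space_simps [simp]:
  "carrier (fun_space A) = Fn ` (A \<rightarrow>\<^sub>E UNIV)"
  "Fn f \<oplus>\<^bsub>fun_space A\<^esub> Fn g = Fn (\<lambda>a\<in>A. f a + g a)" "c \<odot>\<^bsub>fun_space A\<^esub> Fn f = Fn (\<lambda>a\<in>A. c * f a)"
  by (simp_all add: fun_space_def class_ring.func_space_def)

lemma fun_space_vectorspace: "vectorspace class_ring (fun_space A :: ('k::field, ('k, 'a, 'x) point) module)"
proof -
  interpret v: vectorspace class_ring "module_vec TYPE('k) 0" by (rule vec_vs)
  show ?thesis unfolding fun_space_def by (rule relabel_vectorspace[OF v.func_space_is_vs]) simp
qed

text \<open>An enumeration \<open>h\<close> of \<open>A\<close> by the indices below \<open>n\<close> identifies column vectors of length \<open>n\<close> with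
  functions on \<open>A\<close>: the value at \<open>h i\<close> is the \<open>i\<close>-th coordinate.\<close>

definition coord_to_fun ::
  "nat \<Rightarrow> (nat + 'a) set \<Rightarrow> (nat \<Rightarrow> nat + 'a) \<Rightarrow> ('k::field, 'a, 'x) point \<Rightarrow> ('k, 'a, 'x) point" where
  "coord_to_fun n A h =
     (\<lambda>x\<in>carrier (coord_space n). Fn (\<lambda>a\<in>A. the_vec x $ inv_into {..<n} h a))"

definition fun_to_coord ::
  "nat \<Rightarrow> (nat + 'a) set \<Rightarrow> (nat \<Rightarrow> nat + 'a) \<Rightarrow> ('k::field, 'a, 'x) point \<Rightarrow> ('k, 'a, 'x) point" where
  "fun_to_coord n A h = (\<lambda>x\<in>carrier (fun_space A). Vec (vec n (\<lambda>i. the_fn x (h i))))"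

lemma coord_fun_iso:
  assumes h: "bij_betw h {..<n} A"
  shows "coord_to_fun n A h \<in> lin_maps (coord_space n) (fun_space A)"
    and "fun_to_coord n A h \<in> lin_maps (fun_space A) (coord_space n)"
    and "compose (carrier (coord_space n)) (fun_to_coord n A h) (coord_to_fun n A h)
      = (\<lambda>x\<in>carrier (coord_space n). x)"
    and "compose (carrier (fun_space A)) (coord_to_fun n A h) (fun_to_coord n A h)
      = (\<lambda>x\<in>carrier (fun_space A). x)"
proof -
  have i: "inv_into {..<n} h (h k) = k" if "k < n" for k
    using h that by (simp add: bij_betw_def inv_into_f_f)
  have j: "inv_into {..<n} h a < n" "h (inv_into {..<n} h a) = a" if "a \<in> A" for a
    using h that inv_into_into[of a h "{..<n}"] by (auto simp: bij_betw_def f_inv_into_f)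
  have hA: "h k \<in> A" if "k < n" for k using h that by (auto simp: bij_betw_def)
  have m: "Fn (\<lambda>a\<in>A. v $ inv_into {..<n} h a) \<in> Fn ` (A \<rightarrow>\<^sub>E UNIV)" for v by (intro imageI) auto
  show "coord_to_fun n A h \<in> lin_maps (coord_space n) (fun_space A)"
    unfolding lin_maps_iff by (auto simp: coord_to_fun_def j m intro!: restrict_ext)
  show "fun_to_coord n A h \<in> lin_maps (fun_space A) (coord_space n)"
    unfolding lin_maps_iff by (auto simp: fun_to_coord_def hA intro!: eq_vecI)
  show "compose (carrier (coord_space n)) (fun_to_coord n A h) (coord_to_fun n A h)
      = (\<lambda>x\<in>carrier (coord_space n). x)"
    by (rule extensionalityI)
       (auto simp: compose_def fun_to_coord_def coord_to_fun_def i hA m intro!: eq_vecI)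
  show "compose (carrier (fun_space A)) (coord_to_fun n A h) (fun_to_coord n A h)
      = (\<lambda>x\<in>carrier (fun_space A). x)"
    by (rule extensionalityI)
       (auto simp: compose_def fun_to_coord_def coord_to_fun_def j PiE_def extensional_def)
qed

text \<open>An enumeration of \<open>A\<close> makes the function space an image of a coordinate space.\<close>

lemma fun_space_obj:
  assumes "finite A"
  shows "(fun_space A :: ('k::field, ('k, 'a, 'x) point) module) \<in> Obj (Gamma d)"
proof -
  obtain h where h: "bij_betw h {..<card A} A"
    using ex_bij_betw_nat_finite[OF assms] by (auto simp: atLeast0LessThan)
  note iso = coord_fun_iso[OF h]
  have "coord_to_fun (card A) A h ` carrier (coord_space (card A))
      = carrier (fun_space A :: ('k, ('k, 'a, 'x) point) module)"
  proof (intro equalityI subsetI)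
    fix y assume y: "y \<in> carrier (fun_space A)"
    have "y = coord_to_fun (card A) A h (fun_to_coord (card A) A h y)"
      using fun_cong[OF iso(4), of y] y by (simp add: compose_def del: fun_space_simps coord_space_simps)
    moreover have "fun_to_coord (card A) A h y \<in> carrier (coord_space (card A))"
      using iso(2) y unfolding lin_maps_iff by blast
    ultimately show "y \<in> coord_to_fun (card A) A h ` carrier (coord_space (card A))" by blast
  qed (use iso(1) in \<open>unfold lin_maps_iff, blast\<close>)
  moreover have "vectorspace.fin_dim class_ring (coord_space (card A) :: ('k, ('k, 'a, 'x) point) module)"
    using coord_space_obj by (metis Gamma_simps(1))
  ultimately have "vectorspace.fin_dim class_ring (fun_space A :: ('k, ('k, 'a, 'x) point) module)"
    by (rule fin_dim_surj[OF coord_space_vectorspace fun_space_vectorspace lin_maps_hom[OF iso(1)]])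
  then show ?thesis by (simp add: Gamma_simps fun_space_vectorspace)
qed

lemma fun_map_lin: "fun_map A B i \<in> lin_maps (fun_space A) (fun_space B)"
  unfolding lin_maps_iff by (auto simp: fun_map_def inv_into_into intro!: restrict_ext imageI)

lemma fun_map_id: "fun_map A A (\<lambda>a\<in>A. a) = (\<lambda>x\<in>carrier (fun_space A). x)"
proof (rule extensionalityI)
  have "inv_into A (\<lambda>a\<in>A. a) b = b" if "b \<in> A" for b
    using inv_into_f_f[of "\<lambda>a\<in>A. a" A b] that by (simp add: inj_on_def)
  then show "fun_map A A (\<lambda>a\<in>A. a) x = (\<lambda>x\<in>carrier (fun_space A). x) x" if "x \<in> carrier (fun_space A)" for x
    using that by (auto simp: fun_map_def PiE_def extensional_def)
qed (simp_all add: fun_map_def)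

text \<open>Extension by zero, characterized by its values. This form avoids the inverse of \<open>i\<close> in the
  definition.\<close>

lemma fun_map_apply:
  assumes "inj_on i A" "i \<in> A \<rightarrow> B" "f \<in> A \<rightarrow>\<^sub>E UNIV"
  obtains g where "fun_map A B i (Fn f) = Fn g" "g \<in> B \<rightarrow>\<^sub>E UNIV"
    "\<And>a. a \<in> A \<Longrightarrow> g (i a) = f a" "\<And>b. b \<in> B \<Longrightarrow> b \<notin> i ` A \<Longrightarrow> g b = 0"
proof
  show "fun_map A B i (Fn f) = Fn (\<lambda>b\<in>B. if b \<in> i ` A then f (inv_into A i b) else 0)"
    using assms(3) by (simp add: fun_map_def cong: if_cong)
qed (use assms in \<open>auto simp: inv_into_f_f\<close>)

text \<open>A point of \<open>D\<close> comes from \<open>A\<close>, or from \<open>B\<close> but not from \<open>A\<close>, or not even from \<open>B\<close>; injectivity of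
  \<open>j\<close> keeps the second case apart from the first, and in the last two cases both sides vanish.\<close>

lemma fun_map_compose:
  assumes i: "inj_on i A" "i \<in> A \<rightarrow> B" and j: "inj_on j B" "j \<in> B \<rightarrow> D"
  shows "compose (carrier (fun_space A)) (fun_map B D j) (fun_map A B i) = (fun_map A D (compose A j i) :: ('k::field, 'a, 'x) point \<Rightarrow> _)"
proof (rule extensionalityI)
  fix x :: "('k, 'a, 'x) point" assume "x \<in> carrier (fun_space A)"
  then obtain f where f: "f \<in> A \<rightarrow>\<^sub>E UNIV" and x: "x = Fn f" by auto
  have ji: "inj_on (compose A j i) A" "compose A j i \<in> A \<rightarrow> D"
    using i j by (auto simp: compose_def inj_on_def Pi_iff)
  obtain g where g: "fun_map A B i x = Fn g" "g \<in> B \<rightarrow>\<^sub>E UNIV"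
    "\<And>a. a \<in> A \<Longrightarrow> g (i a) = f a" "\<And>b. b \<in> B \<Longrightarrow> b \<notin> i ` A \<Longrightarrow> g b = 0"
    using fun_map_apply[OF i f] unfolding x by blast
  obtain k where k: "fun_map B D j (Fn g :: ('k, 'a, 'x) point) = Fn k" "k \<in> D \<rightarrow>\<^sub>E UNIV"
    "\<And>a. a \<in> B \<Longrightarrow> k (j a) = g a" "\<And>b. b \<in> D \<Longrightarrow> b \<notin> j ` B \<Longrightarrow> k b = 0"
    using fun_map_apply[OF j g(2)] by blast
  obtain l where l: "fun_map A D (compose A j i) x = Fn l" "l \<in> D \<rightarrow>\<^sub>E UNIV"
    "\<And>a. a \<in> A \<Longrightarrow> l (compose A j i a) = f a" "\<And>b. b \<in> D \<Longrightarrow> b \<notin> compose A j i ` A \<Longrightarrow> l b = 0"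
    using fun_map_apply[OF ji f] unfolding x by blast
  have "k = l"
  proof (rule PiE_ext[OF k(2) l(2)])
    fix b assume b: "b \<in> D"
    consider a where "a \<in> A" "b = j (i a)" | c where "c \<in> B" "c \<notin> i ` A" "b = j c" | "b \<notin> j ` B" by blast
    then show "k b = l b"
    proof cases
      case 1 then show ?thesis using i(2) k(3)[of "i a"] g(3)[of a] l(3)[of a] by (auto simp: compose_def)
    next
      case 2
      then have "b \<notin> compose A j i ` A" using j(1) i(2) by (auto simp: compose_def inj_on_def Pi_iff)
      then show ?thesis using 2 k(3) g(4) l(4) b by simp
    next
      case 3
      then have "b \<notin> compose A j i ` A" using i(2) by (auto simp: compose_def)
      then show ?thesis using 3 k(4) l(4) b by simp
    qed
  qed
  then show "compose (carrier (fun_space A)) (fun_map B D j) (fun_map A B i) x = fun_map A D (compose A j i) x"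
    using f by (simp add: compose_def g(1)[unfolded x] k(1) l(1)[unfolded x compose_def] x)
qed (simp_all add: fun_map_def)

lemma fun_fctr_functor: "is_functor FI (Gamma d) (fun_fctr d)"
proof (rule functor_intro[OF FI_is_category Gamma_is_category], goal_cases)
  case (1 A) then show ?case by (simp add: FI_simps fun_fctr_def fun_space_obj)
next
  case (2 A B i) then show ?case
    by (simp add: FI_simps fun_fctr_def tensor_map_in_Gamma fun_space_vectorspace fun_map_lin)
next
  case (3 A) then show ?case
    by (simp add: FI_simps Gamma_simps fun_fctr_def fun_map_id tensor_map_id fun_space_vectorspace
      del: fun_space_simps)
next
  case (4 A B D i j)
  then have "i \<in> A \<rightarrow> B" "inj_on i A" "j \<in> B \<rightarrow> D" "inj_on j B" by (auto simp: FI_simps)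
  then show ?case
    by (simp add: FI_simps Gamma_simps fun_fctr_def fun_map_compose[symmetric]
      tensor_map_compose fun_space_vectorspace fun_map_lin del: fun_space_simps)
qed

lemma mat_map_lin:
  assumes "T \<in> carrier_mat n n" shows "mat_map n T \<in> lin_maps (coord_space n) (coord_space n)"
  unfolding lin_maps_iff using assms
  by (auto simp: mat_map_def mult_add_distrib_mat_vec[of T n n] mult_mat_vec[of T n n])

lemma mat_map_mult:
  assumes "S \<in> carrier_mat n n" "T \<in> carrier_mat n n"
  shows "mat_map n (S * T) = compose (carrier (coord_space n)) (mat_map n S) (mat_map n T)"
  using assms by (auto simp: mat_map_def compose_def assoc_mult_mat_vec[of S n n T n] intro!: restrict_ext)

lemma mat_map_one: "mat_map n (1\<^sub>m n) = (\<lambda>x\<in>carrier (coord_space n). x)"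
  by (auto simp: mat_map_def intro!: restrict_ext)


section \<open>Polynomiality of the action of the general linear group\<close>

lemma tensor_rel_finsum:
  assumes V: "vectorspace class_ring (V :: ('k::field, 'v) module)" and z: "z \<in> tuples d V" and j: "j \<in> {1..d}"
    and A: "finite A" and v: "\<And>a. a \<in> A \<Longrightarrow> v a \<in> carrier V"
  shows "Poly_Mapping.single (z(j := finsum V (\<lambda>a. c a \<odot>\<^bsub>V\<^esub> v a) A)) b
    - (\<Sum>a\<in>A. Poly_Mapping.single (z(j := v a)) (b * c a)) \<in> tensor_rels d V"
  using A v
proof (induction A rule: finite_induct)
  interpret vectorspace class_ring V by fact
  { case empty
    show ?case using tensor_rel_smult[OF V z j, of "\<zero>\<^bsub>V\<^esub>" 0 b] vectorspace_closed(3,4)[OF V] by (simp add: fun_upd_def)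
  next
    case (insert a A)
    let ?s = "\<lambda>u b. Poly_Mapping.single (z(j := u)) b"
    let ?S = "finsum V (\<lambda>a. c a \<odot>\<^bsub>V\<^esub> v a) A"
    have S: "?S \<in> carrier V" by (rule finsum_closed) (use insert.prems vectorspace_closed(2)[OF V] in auto)
    have fs: "finsum V (\<lambda>a. c a \<odot>\<^bsub>V\<^esub> v a) (insert a A) = c a \<odot>\<^bsub>V\<^esub> v a \<oplus>\<^bsub>V\<^esub> ?S"
      by (rule finsum_insert) (use insert vectorspace_closed(2)[OF V] in auto)
    have va: "v a \<in> carrier V" "c a \<odot>\<^bsub>V\<^esub> v a \<in> carrier V"
      using insert.prems[of a] vectorspace_closed(2)[OF V, of "v a" "c a"] by simp_all
    have "?s (finsum V (\<lambda>a. c a \<odot>\<^bsub>V\<^esub> v a) (insert a A)) b - (\<Sum>a\<in>insert a A. ?s (v a) (b * c a))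
      = (?s (c a \<odot>\<^bsub>V\<^esub> v a \<oplus>\<^bsub>V\<^esub> ?S) b - ?s (c a \<odot>\<^bsub>V\<^esub> v a) b - ?s ?S b)
        + (?s (c a \<odot>\<^bsub>V\<^esub> v a) b - ?s (v a) (b * c a)) + (?s ?S b - (\<Sum>a\<in>A. ?s (v a) (b * c a)))"
      by (simp add: fs insert.hyps)
    moreover have "?s ?S b - (\<Sum>a\<in>A. ?s (v a) (b * c a)) \<in> tensor_rels d V"
      using insert.IH insert.prems by (simp add: fun_upd_def)
    ultimately have "?s (finsum V (\<lambda>a. c a \<odot>\<^bsub>V\<^esub> v a) (insert a A)) b - (\<Sum>a\<in>insert a A. ?s (v a) (b * c a))
      \<in> tensor_rels d V"
      by (simp only: tensor_rels_closed(2)[OF V] tensor_rel_add[OF V z j va(2) S] tensor_rel_smult[OF V z j va(1)])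
    then show ?case by (simp only: fun_upd_def) }
qed

text \<open>Expanding linear combinations in several slots at once. The induction runs over the set \<open>J\<close> of slots
  that hold a linear combination; the tuple \<open>y\<close> in the other slots stays arbitrary, so that in the
  induction step slot \<open>j\<close> can be counted among them and expanded afterwards.\<close>

lemma tensor_rel_expand_on:
  assumes V: "vectorspace class_ring (V :: ('k::field, 'v) module)"
    and A: "finite A" and v: "\<And>k a. k \<in> {1..d} \<Longrightarrow> a \<in> A \<Longrightarrow> v k a \<in> carrier V"
    and J: "finite J" "J \<subseteq> {1..d}" and y: "y \<in> tuples d V"
  shows "Poly_Mapping.single (\<lambda>k\<in>{1..d}. if k \<in> J then finsum V (\<lambda>a. c a \<odot>\<^bsub>V\<^esub> v k a) A else y k) 1
    - (\<Sum>w\<in>J \<rightarrow>\<^sub>E A. Poly_Mapping.single (\<lambda>k\<in>{1..d}. if k \<in> J then v k (w k) else y k) (\<Prod>k\<in>J. c (w k)))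
    \<in> tensor_rels d V"
  using J y
proof (induction J arbitrary: y rule: finite_induct)
  case empty
  show ?case using tensor_rels_closed(1)[OF V] by simp
next
  case (insert j J)
  interpret vectorspace class_ring V by fact
  let ?S = "\<lambda>k. finsum V (\<lambda>a. c a \<odot>\<^bsub>V\<^esub> v k a) A"
  let ?z = "\<lambda>w. \<lambda>k\<in>{1..d}. if k \<in> J then v k (w k) else y k"
  have j: "j \<in> {1..d}" and JD: "J \<subseteq> {1..d}" using insert.prems by auto
  have S: "?S k \<in> carrier V" if "k \<in> {1..d}" for k
    by (rule finsum_closed) (use v that vectorspace_closed(2)[OF V] in auto)
  have y': "y(j := ?S j) \<in> tuples d V" by (rule tuples_upd[OF insert.prems(2) j S[OF j]])
  have z: "?z w \<in> tuples d V" if "w \<in> J \<rightarrow>\<^sub>E A" for w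
    using that JD v tuples_mem[OF insert.prems(2)] by (auto simp: tuples_def PiE_def Pi_iff)
  \<comment> \<open>Slot \<open>j\<close> moves from \<open>J\<close> to the fixed tuple, and each choice in it extends a word on \<open>J\<close>.\<close>
  have e1: "(\<lambda>k\<in>{1..d}. if k \<in> insert j J then ?S k else y k) = (\<lambda>k\<in>{1..d}. if k \<in> J then ?S k else (y(j := ?S j)) k)"
    using insert.hyps by (auto simp: fun_eq_iff)
  have e2: "(\<lambda>k\<in>{1..d}. if k \<in> J then v k (w k) else (y(j := ?S j)) k) = (?z w)(j := ?S j)" for w
    using insert.hyps j by (auto simp: fun_eq_iff)
  have e3: "(\<lambda>k\<in>{1..d}. if k \<in> insert j J then v k ((w(j := a)) k) else y k) = (?z w)(j := v j a)" for w a
    using insert.hyps j by (auto simp: fun_eq_iff)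
  have e4: "(\<Prod>k\<in>insert j J. c ((w(j := a)) k)) = (\<Prod>k\<in>J. c (w k)) * c a" for w a
  proof -
    have "(\<Prod>k\<in>J. c ((w(j := a)) k)) = (\<Prod>k\<in>J. c (w k))"
      by (rule prod.cong) (use insert.hyps in auto)
    then show ?thesis using insert.hyps by (simp add: mult.commute)
  qed
  have "(\<Sum>w\<in>insert j J \<rightarrow>\<^sub>E A. Poly_Mapping.single (\<lambda>k\<in>{1..d}. if k \<in> insert j J then v k (w k) else y k) (\<Prod>k\<in>insert j J. c (w k)))
    = (\<Sum>(a, w)\<in>A \<times> (J \<rightarrow>\<^sub>E A). Poly_Mapping.single ((?z w)(j := v j a)) ((\<Prod>k\<in>J. c (w k)) * c a))"
    unfolding PiE_insert_eq
    by (subst sum.reindex[OF inj_combinator[OF insert.hyps(2), of "\<lambda>_. A"]])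
       (rule sum.cong[OF refl], simp only: comp_def case_prod_unfold e3 e4)
  also have "\<dots> = (\<Sum>w\<in>J \<rightarrow>\<^sub>E A. \<Sum>a\<in>A. Poly_Mapping.single ((?z w)(j := v j a)) ((\<Prod>k\<in>J. c (w k)) * c a))"
    by (subst sum.cartesian_product[symmetric], rule sum.swap)
  finally have sum: "(\<Sum>w\<in>insert j J \<rightarrow>\<^sub>E A. Poly_Mapping.single (\<lambda>k\<in>{1..d}. if k \<in> insert j J then v k (w k) else y k) (\<Prod>k\<in>insert j J. c (w k)))
    = (\<Sum>w\<in>J \<rightarrow>\<^sub>E A. \<Sum>a\<in>A. Poly_Mapping.single ((?z w)(j := v j a)) ((\<Prod>k\<in>J. c (w k)) * c a))" .
  have "Poly_Mapping.single (\<lambda>k\<in>{1..d}. if k \<in> J then ?S k else (y(j := ?S j)) k) 1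
    - (\<Sum>w\<in>J \<rightarrow>\<^sub>E A. Poly_Mapping.single ((?z w)(j := ?S j)) (\<Prod>k\<in>J. c (w k))) \<in> tensor_rels d V"
    using insert.IH[OF JD y'] unfolding e2 .
  moreover have "(\<Sum>w\<in>J \<rightarrow>\<^sub>E A. Poly_Mapping.single ((?z w)(j := ?S j)) (\<Prod>k\<in>J. c (w k))
      - (\<Sum>a\<in>A. Poly_Mapping.single ((?z w)(j := v j a)) ((\<Prod>k\<in>J. c (w k)) * c a))) \<in> tensor_rels d V"
    by (rule tensor_rels_sum[OF V], rule tensor_rel_finsum[OF V z j A]) (use v j in auto)
  ultimately have "(Poly_Mapping.single (\<lambda>k\<in>{1..d}. if k \<in> J then ?S k else (y(j := ?S j)) k) 1
    - (\<Sum>w\<in>J \<rightarrow>\<^sub>E A. Poly_Mapping.single ((?z w)(j := ?S j)) (\<Prod>k\<in>J. c (w k))))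
    + (\<Sum>w\<in>J \<rightarrow>\<^sub>E A. Poly_Mapping.single ((?z w)(j := ?S j)) (\<Prod>k\<in>J. c (w k))
      - (\<Sum>a\<in>A. Poly_Mapping.single ((?z w)(j := v j a)) ((\<Prod>k\<in>J. c (w k)) * c a))) \<in> tensor_rels d V"
    by (rule tensor_rels_closed(2)[OF V])
  then show ?case unfolding e1 sum by (simp only: sum_subtractf add_diff_eq diff_add_cancel)
qed

text \<open>The distributive law for tensors: one summand for each way of choosing a term in every slot.\<close>

lemma tensor_rel_expand:
  assumes V: "vectorspace class_ring (V :: ('k::field, 'v) module)"
    and A: "finite A" and v: "\<And>k a. k \<in> {1..d} \<Longrightarrow> a \<in> A \<Longrightarrow> v k a \<in> carrier V"
  shows "Poly_Mapping.single (\<lambda>k\<in>{1..d}. finsum V (\<lambda>a. c a \<odot>\<^bsub>V\<^esub> v k a) A) 1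
    - (\<Sum>w\<in>{1..d} \<rightarrow>\<^sub>E A. Poly_Mapping.single (\<lambda>k\<in>{1..d}. v k (w k)) (\<Prod>k\<in>{1..d}. c (w k)))
    \<in> tensor_rels d V"
proof -
  have y: "(\<lambda>k\<in>{1..d}. \<zero>\<^bsub>V\<^esub>) \<in> tuples d V" using vectorspace_closed(3)[OF V] by (simp add: tuples_def)
  have r: "(\<lambda>k\<in>{1..d}. if k \<in> {1..d} then f k else (\<lambda>k\<in>{1..d}. \<zero>\<^bsub>V\<^esub>) k) = (\<lambda>k\<in>{1..d}. f k)" for f :: "nat \<Rightarrow> 'v"
    by auto
  show ?thesis
    using tensor_rel_expand_on[OF V A v finite_atLeastAtMost order_refl y, where c = c] unfolding r by simp
qed

definition unit_mat :: "nat \<Rightarrow> nat \<times> nat \<Rightarrow> 'k::field mat" where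
  "unit_mat n ij = mat n n (\<lambda>ab. if ab = ij then 1 else 0)"

lemma unit_mat_carrier: "unit_mat n ij \<in> carrier_mat n n"
  by (simp add: unit_mat_def)

lemma unit_mat_mult_vec:
  assumes "x \<in> carrier_vec n" "i < n" "b < n"
  shows "(unit_mat n (a, b) *\<^sub>v x) $ i = (if i = a then x $ b else 0)"
proof -
  have "(unit_mat n (a, b) *\<^sub>v x) $ i = (\<Sum>k = 0..<n. (if i = a \<and> k = b then 1 else 0) * x $ k)"
    using assms by (simp add: unit_mat_def scalar_prod_def)
  also have "\<dots> = (\<Sum>k = 0..<n. if k = b then (if i = a then x $ b else 0) else 0)"
    by (rule sum.cong) auto
  finally show ?thesis using assms by simp
qed

lemma finsum_coord_space:
  fixes v :: "'i \<Rightarrow> 'k::field vec"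
  assumes "finite A" "\<And>a. a \<in> A \<Longrightarrow> v a \<in> carrier_vec n"
  shows "finsum (coord_space n :: ('k, ('k, 'a, 'x) point) module) (\<lambda>a. c a \<odot>\<^bsub>coord_space n\<^esub> Vec (v a)) A
    = Vec (vec n (\<lambda>i. \<Sum>a\<in>A. c a * v a $ i))"
  using assms
proof (induction A rule: finite_induct)
  interpret vectorspace class_ring "coord_space n :: ('k, ('k, 'a, 'x) point) module"
    by (rule coord_space_vectorspace)
  { case empty
    show ?case by (auto intro!: eq_vecI)
  next
    case (insert a A)
    have "finsum (coord_space n :: ('k, ('k, 'a, 'x) point) module) (\<lambda>a. c a \<odot>\<^bsub>coord_space n\<^esub> Vec (v a)) (insert a A)
      = c a \<odot>\<^bsub>coord_space n\<^esub> Vec (v a) \<oplus>\<^bsub>coord_space n\<^esub> finsum (coord_space n) (\<lambda>a. c a \<odot>\<^bsub>coord_space n\<^esub> Vec (v a)) A"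
      by (rule finsum_insert) (use insert in auto)
    also have "\<dots> = Vec (vec n (\<lambda>i. \<Sum>a\<in>insert a A. c a * v a $ i))"
    proof -
      have dim: "dim_vec (v a) = n" using insert.prems[of a] by simp
      have "(c a \<cdot>\<^sub>v v a) $ i = c a * v a $ i" if "i < n" for i using dim that by simp
      then show ?thesis using insert by (auto intro!: eq_vecI)
    qed
    finally show ?case . }
qed

lemma mat_map_expand:
  assumes T: "T \<in> carrier_mat n n" and x: "x \<in> carrier (coord_space n :: ('k::field, ('k, 'a, 'x) point) module)"
  shows "mat_map n T x = finsum (coord_space n)
    (\<lambda>ij. T $$ ij \<odot>\<^bsub>coord_space n\<^esub> mat_map n (unit_mat n ij) x) ({..<n} \<times> {..<n})"
proof -
  obtain v where v: "v \<in> carrier_vec n" "x = Vec v" using x by auto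
  have E: "mat_map n (unit_mat n ij) x = Vec (unit_mat n ij *\<^sub>v v)" for ij
    using v by (simp add: mat_map_def)
  have "(T *\<^sub>v v) $ i = (\<Sum>ij\<in>{..<n} \<times> {..<n}. T $$ ij * (unit_mat n ij *\<^sub>v v) $ i)" if i: "i < n" for i
  proof -
    have "(\<Sum>ij\<in>{..<n} \<times> {..<n}. T $$ ij * (unit_mat n ij *\<^sub>v v) $ i)
      = (\<Sum>a<n. \<Sum>b<n. T $$ (a, b) * (unit_mat n (a, b) *\<^sub>v v) $ i)"
      by (simp add: sum.cartesian_product case_prod_unfold)
    also have "\<dots> = (\<Sum>a<n. \<Sum>b<n. if a = i then T $$ (i, b) * v $ b else 0)"
      by (intro sum.cong) (auto simp: unit_mat_mult_vec[OF v(1) i])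
    also have "\<dots> = (\<Sum>a<n. if a = i then (\<Sum>b<n. T $$ (i, b) * v $ b) else 0)"
      by (intro sum.cong) auto
    also have "\<dots> = (\<Sum>b<n. T $$ (i, b) * v $ b)" using i by simp
    also have "\<dots> = (T *\<^sub>v v) $ i"
      using i T v(1) by (simp add: scalar_prod_def atLeast0LessThan)
    finally show ?thesis ..
  qed
  then have "T *\<^sub>v v = vec n (\<lambda>i. \<Sum>ij\<in>{..<n} \<times> {..<n}. T $$ ij * (unit_mat n ij *\<^sub>v v) $ i)"
    using T by (intro eq_vecI) auto
  moreover have "finsum (coord_space n :: ('k, ('k, 'a, 'x) point) module)
      (\<lambda>ij. T $$ ij \<odot>\<^bsub>coord_space n\<^esub> Vec (unit_mat n ij *\<^sub>v v)) ({..<n} \<times> {..<n})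
    = Vec (vec n (\<lambda>i. \<Sum>ij\<in>{..<n} \<times> {..<n}. T $$ ij * (unit_mat n ij *\<^sub>v v) $ i))"
    by (rule finsum_coord_space) (simp_all add: mult_mat_vec_carrier[OF unit_mat_carrier v(1)])
  ultimately show ?thesis
    unfolding E using v by (simp add: mat_map_def del: coord_space_simps(3))
qed

abbreviation words :: "nat \<Rightarrow> nat \<Rightarrow> (nat \<Rightarrow> nat \<times> nat) set" where
  "words d n \<equiv> {1..d} \<rightarrow>\<^sub>E {..<n} \<times> {..<n}"

text \<open>The exponent vector of the monomial that belongs to the word \<open>w\<close>.\<close>

definition word_type :: "nat \<Rightarrow> nat \<Rightarrow> (nat \<Rightarrow> nat \<times> nat) \<Rightarrow> (nat \<times> nat \<Rightarrow> nat)" where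
  "word_type d n w = (\<lambda>ij\<in>{..<n} \<times> {..<n}. card {k \<in> {1..d}. w k = ij})"

abbreviation word_types :: "nat \<Rightarrow> nat \<Rightarrow> (nat \<times> nat \<Rightarrow> nat) set" where
  "word_types d n \<equiv> {e \<in> {..<n} \<times> {..<n} \<rightarrow>\<^sub>E {..d}. sum e ({..<n} \<times> {..<n}) = d}"

definition word_map :: "nat \<Rightarrow> nat \<Rightarrow> (nat \<Rightarrow> nat \<times> nat) \<Rightarrow> (nat \<Rightarrow> ('k::field, 'a, 'x) point) \<Rightarrow> (nat \<Rightarrow> ('k, 'a, 'x) point)" where
  "word_map d n w = slotwise d (\<lambda>k. mat_map n (unit_mat n (w k))) id"

text \<open>The coefficient of the monomial with exponents \<open>e\<close> in the \<open>d\<close>-th tensor power of a generic matrix: the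
  sum of \<open>E\<^bsub>w 1\<^esub> \<otimes> \<dots> \<otimes> E\<^bsub>w d\<^esub>\<close> over the words \<open>w\<close> of type \<open>e\<close>.\<close>

definition monomial_map ::
  "nat \<Rightarrow> nat \<Rightarrow> (nat \<times> nat \<Rightarrow> nat) \<Rightarrow> ((nat \<Rightarrow> ('k::field, 'a, 'x) point) \<Rightarrow>\<^sub>0 'k) \<Rightarrow> ((nat \<Rightarrow> ('k, 'a, 'x) point) \<Rightarrow>\<^sub>0 'k)" where
  "monomial_map d n e = (\<lambda>p. \<Sum>w | w \<in> words d n \<and> word_type d n w = e. free_map (word_map d n w) p)"

lemma finite_words: "finite (words d n)"
  by (simp add: finite_PiE)

lemma word_type_in_word_types:
  assumes "w \<in> words d n" shows "word_type d n w \<in> word_types d n"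
proof -
  have img: "w ` {1..d} \<subseteq> {..<n} \<times> {..<n}" using assms by blast
  have "card {k \<in> {1..d}. w k = ij} \<le> card {1..d}" for ij by (rule card_mono) auto
  moreover have "(\<Sum>ij\<in>{..<n} \<times> {..<n}. \<Sum>k | k \<in> {1..d} \<and> w k = ij. 1) = (\<Sum>k\<in>{1..d}. 1::nat)"
    by (rule sum.group[OF _ _ img]) simp_all
  ultimately show ?thesis by (auto simp: word_type_def)
qed

lemma prod_word:
  assumes "w \<in> words d n"
  shows "(\<Prod>k\<in>{1..d}. T $$ w k) = (\<Prod>ij\<in>{..<n} \<times> {..<n}. (T $$ ij :: 'k::field) ^ word_type d n w ij)"
proof -
  have img: "w ` {1..d} \<subseteq> {..<n} \<times> {..<n}" using assms by blast
  have "(\<Prod>k\<in>{1..d}. T $$ w k) = (\<Prod>ij\<in>{..<n} \<times> {..<n}. \<Prod>k | k \<in> {1..d} \<and> w k = ij. T $$ w k)"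
    by (rule prod.group[OF _ _ img, symmetric]) simp_all
  also have "\<dots> = (\<Prod>ij\<in>{..<n} \<times> {..<n}. T $$ ij ^ word_type d n w ij)"
    by (intro prod.cong) (simp_all add: word_type_def)
  finally show ?thesis .
qed

lemma tensorial_monomial_map: "tensorial d (coord_space n) (coord_space n) (monomial_map d n e)"
  unfolding monomial_map_def word_map_def
  by (intro tensorial_sum tensorial_slotwise coord_space_vectorspace lin_maps_hom mat_map_lin unit_mat_carrier permutes_id)

lemma word_type_perm:
  assumes "\<pi> permutes {1..d}"
  shows "word_type d n (\<lambda>k\<in>{1..d}. w (\<pi> k)) = word_type d n w"
proof -
  have "card {k \<in> {1..d}. (\<lambda>k\<in>{1..d}. w (\<pi> k)) k = ij} = card {k \<in> {1..d}. w k = ij}" for ij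
  proof -
    have res: "{k \<in> {1..d}. (\<lambda>k\<in>{1..d}. w (\<pi> k)) k = ij} = {k \<in> {1..d}. w (\<pi> k) = ij}" by auto
    have img: "\<pi> ` {k \<in> {1..d}. w (\<pi> k) = ij} = {k \<in> {1..d}. w k = ij}"
    proof (intro equalityI subsetI)
      fix k assume k: "k \<in> {k \<in> {1..d}. w k = ij}"
      then have "k \<in> \<pi> ` {1..d}" using permutes_image[OF assms] by simp
      then show "k \<in> \<pi> ` {k \<in> {1..d}. w (\<pi> k) = ij}" using k by blast
    next
      fix k assume "k \<in> \<pi> ` {k \<in> {1..d}. w (\<pi> k) = ij}"
      then show "k \<in> {k \<in> {1..d}. w k = ij}" using permutes_in_image[OF assms] by blast
    qed
    have "inj_on \<pi> {k \<in> {1..d}. w (\<pi> k) = ij}" using permutes_inj[OF assms] by (rule inj_on_subset) simp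
    then show ?thesis unfolding res img[symmetric] by (rule card_image[symmetric])
  qed
  then show ?thesis by (simp add: word_type_def)
qed

text \<open>Conjugating \<open>E\<^bsub>w 1\<^esub> \<otimes> \<dots> \<otimes> E\<^bsub>w d\<^esub>\<close> by a permutation of the factors permutes the letters of \<open>w\<close>. A single such
  operator is therefore not equivariant in general, but permuting letters preserves the type, so the sum over all
  words of one type is. This is why \<open>F\<close> can be applied to it.\<close>

lemma monomial_map_equivariant:
  assumes \<pi>: "\<pi> permutes {1..d}"
  shows "monomial_map d n e (Poly_Mapping.single (slot_perm d \<pi> x) 1)
    = free_map (slot_perm d \<pi>) (monomial_map d n e (Poly_Mapping.single x 1))"
proof -
  have p1: "\<pi> k \<in> {1..d}" "inv' \<pi> k \<in> {1..d}" if "k \<in> {1..d}" for k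
    using permutes_in_image[OF \<pi>] permutes_in_image[OF permutes_inv[OF \<pi>]] that by blast+
  have p2: "\<pi> (inv' \<pi> k) = k" "inv' \<pi> (\<pi> k) = k" for k using permutes_inverses[OF \<pi>] by simp_all
  let ?W = "{w. w \<in> words d n \<and> word_type d n w = e}"
  let ?f = "\<lambda>\<pi>. \<lambda>w :: nat \<Rightarrow> nat \<times> nat. \<lambda>k\<in>{1..d}. w (\<pi> k)"
  have m: "?f \<sigma> w \<in> ?W" if "w \<in> ?W" "\<sigma> permutes {1..d}" for w \<sigma>
  proof -
    have "\<sigma> k \<in> {1..d}" if "k \<in> {1..d}" for k
      using permutes_in_image[OF \<open>\<sigma> permutes {1..d}\<close>] that by blast
    then have "?f \<sigma> w \<in> words d n" using that(1) by (intro restrict_PiE_iff[THEN iffD2]) blast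
    then show ?thesis using that(1) word_type_perm[OF that(2)] by simp
  qed
  have "(\<Sum>w\<in>?W. Poly_Mapping.single (word_map d n w (slot_perm d \<pi> x)) 1)
    = (\<Sum>w\<in>?W. Poly_Mapping.single (slot_perm d \<pi> (word_map d n w x)) (1::'a))"
  proof (rule sum.reindex_bij_witness[where i = "?f (inv' \<pi>)" and j = "?f \<pi>"])
    fix w assume w: "w \<in> ?W"
    show "?f \<pi> w \<in> ?W" by (rule m[OF w \<pi>])
    show "?f (inv' \<pi>) w \<in> ?W" by (rule m[OF w permutes_inv[OF \<pi>]])
    show "?f (inv' \<pi>) (?f \<pi> w) = w" "?f \<pi> (?f (inv' \<pi>) w) = w"
      using w p1 p2 by (auto simp: fun_eq_iff PiE_def extensional_def simp del: atLeastAtMost_iff)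
    have "slot_perm d \<pi> (word_map d n (?f \<pi> w) x) = word_map d n w (slot_perm d \<pi> x)"
      using p1 p2 by (auto simp: slotwise_def word_map_def fun_eq_iff simp del: atLeastAtMost_iff)
    then show "Poly_Mapping.single (slot_perm d \<pi> (word_map d n (?f \<pi> w) x)) 1
      = Poly_Mapping.single (word_map d n w (slot_perm d \<pi> x)) (1::'a)" by simp
  qed
  then show ?thesis by (simp add: monomial_map_def free_linear_simps(6)[OF free_map_linear])
qed

text \<open>The tensor power of \<open>T\<close> is a combination of fixed equivariant operators, and the coefficients are
  the monomials of degree \<open>d\<close> in the entries of \<open>T\<close>.\<close>

lemma tensor_map_expand:
  assumes T: "T \<in> carrier_mat n n"
  shows "tensor_map d (coord_space n) (coord_space n) (mat_map n T :: ('k::field, 'a, 'x) point \<Rightarrow> _)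
    = descend d (coord_space n) (coord_space n)
        (\<lambda>p. \<Sum>e\<in>word_types d n. scl (\<Prod>ij\<in>{..<n} \<times> {..<n}. (T $$ ij) ^ e ij) (monomial_map d n e p))"
  unfolding tensor_map_descend
proof (rule descend_eqI[OF coord_space_vectorspace coord_space_vectorspace
      tensorial_tensor_map[OF coord_space_vectorspace coord_space_vectorspace mat_map_lin[OF T]]])
  let ?V = "coord_space n :: ('k, ('k, 'a, 'x) point) module"
  let ?B = "{..<n} \<times> {..<n}"
  show "tensorial d ?V ?V (\<lambda>p. \<Sum>e\<in>word_types d n. scl (\<Prod>ij\<in>?B. (T $$ ij) ^ e ij) (monomial_map d n e p))"
    by (intro tensorial_sum tensorial_scl tensorial_monomial_map coord_space_vectorspace)
  fix x assume x: "x \<in> tuples d ?V"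
  have Ex: "mat_map n (unit_mat n ij) (x k) \<in> carrier ?V" if "k \<in> {1..d}" for k ij
    using mat_map_lin[OF unit_mat_carrier] tuples_mem[OF x that] unfolding lin_maps_iff by blast
  have Tx: "slotwise d (\<lambda>_. mat_map n T) id x
    = (\<lambda>k\<in>{1..d}. finsum ?V (\<lambda>ij. T $$ ij \<odot>\<^bsub>?V\<^esub> mat_map n (unit_mat n ij) (x k)) ?B)"
    unfolding slotwise_def using mat_map_expand[OF T tuples_mem[OF x]] by (intro restrict_ext) simp
  have fin: "finite (word_types d n)" by (rule finite_subset[of _ "?B \<rightarrow>\<^sub>E {..d}"]) (auto simp: finite_PiE)
  \<comment> \<open>The monomial of a word depends only on its type, so it can be pulled out of the sum over one type.\<close>
  have mono: "scl (\<Prod>ij\<in>?B. (T $$ ij) ^ e ij) (monomial_map d n e (Poly_Mapping.single x 1))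
    = (\<Sum>w | w \<in> words d n \<and> word_type d n w = e.
         Poly_Mapping.single (word_map d n w x) (\<Prod>k\<in>{1..d}. T $$ w k))" for e
    unfolding monomial_map_def scl_sum by (rule sum.cong[OF refl]) (auto simp: prod_word[simplified])
  have "(\<Sum>e\<in>word_types d n. scl (\<Prod>ij\<in>?B. (T $$ ij) ^ e ij) (monomial_map d n e (Poly_Mapping.single x 1)))
    = (\<Sum>e\<in>word_types d n. \<Sum>w | w \<in> words d n \<and> word_type d n w = e.
         Poly_Mapping.single (word_map d n w x) (\<Prod>k\<in>{1..d}. T $$ w k))"
    by (simp only: mono)
  also have "\<dots> = (\<Sum>w\<in>words d n. Poly_Mapping.single (word_map d n w x) (\<Prod>k\<in>{1..d}. T $$ w k))"
    by (rule sum.group[OF finite_words fin]) (use word_type_in_word_types in blast)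
  also have "\<dots> = (\<Sum>w\<in>words d n. Poly_Mapping.single (\<lambda>k\<in>{1..d}. mat_map n (unit_mat n (w k)) (x k)) (\<Prod>k\<in>{1..d}. T $$ w k))"
    by (simp add: word_map_def slotwise_def)
  finally show "free_map (slotwise d (\<lambda>_. mat_map n T) id) (Poly_Mapping.single x 1)
    - (\<Sum>e\<in>word_types d n. scl (\<Prod>ij\<in>?B. (T $$ ij) ^ e ij) (monomial_map d n e (Poly_Mapping.single x 1)))
    \<in> tensor_rels d ?V"
    using tensor_rel_expand[OF coord_space_vectorspace _ Ex, where A = ?B and c = "\<lambda>ij. T $$ ij"]
    by (simp add: Tx)
qed

text \<open>The linearity of \<open>F\<close> on morphisms, for a finite combination of equivariant maps, seen through a
  matrix coefficient of the resulting operator.\<close>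

lemma K_linear_combination:
  assumes F: "is_functor (Gamma d) Vect F" and lin: "K_linear d F" and V: "V \<in> Obj (Gamma d)"
    and S: "finite S" and L: "\<And>e. e \<in> S \<Longrightarrow> tensorial d V V (L e)"
    and eqv: "\<And>e \<pi> x. e \<in> S \<Longrightarrow> \<pi> permutes {1..d} \<Longrightarrow>
      L e (Poly_Mapping.single (slot_perm d \<pi> x) 1) = free_map (slot_perm d \<pi>) (L e (Poly_Mapping.single x 1))"
    and x: "x \<in> carrier (fob F V)" and l: "l \<in> module_hom class_ring (fob F V) line"
  shows "l (fmor F V V (descend d V V (\<lambda>p. \<Sum>e\<in>S. scl (c e) (L e p))) x)
    = (\<Sum>e\<in>S. c e * l (fmor F V V (descend d V V (L e)) x))"
proof -
  have vs: "vectorspace class_ring V" using V by (simp add: Gamma_simps)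
  have l_add: "l (a \<oplus>\<^bsub>fob F V\<^esub> b) = l a + l b" if "a \<in> carrier (fob F V)" "b \<in> carrier (fob F V)" for a b
    using l that by (simp add: module_hom_iff line_def)
  have l_smult: "l (r \<odot>\<^bsub>fob F V\<^esub> a) = r * l a" if "a \<in> carrier (fob F V)" for a r
    using l that by (simp add: module_hom_iff line_def)
  have F_mem: "fmor F V V f x \<in> carrier (fob F V)" if "f \<in> Mor (Gamma d) V V" for f
    using functor_mor[OF F V V that] x by (simp add: Vect_simps lin_maps_iff)
  have F_add: "fmor F V V (hom_add (tensor_power d V) (tensor_power d V) f g) x = fmor F V V f x \<oplus>\<^bsub>fob F V\<^esub> fmor F V V g x"
    if "f \<in> Mor (Gamma d) V V" "g \<in> Mor (Gamma d) V V" for f g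
    using lin V that x by (simp add: K_linear_def hom_add_def)
  have F_smult: "fmor F V V (hom_smult (tensor_power d V) (tensor_power d V) r f) x = r \<odot>\<^bsub>fob F V\<^esub> fmor F V V f x"
    if "f \<in> Mor (Gamma d) V V" for f r
    using lin V that x by (simp add: K_linear_def hom_smult_def)
  have ids: "tensorial d V V (\<lambda>p. p)" by (simp add: tensorial_def free_linear_def)
  have idm: "descend d V V (\<lambda>p. p) \<in> Mor (Gamma d) V V"
    by (rule descend_in_Gamma[OF vs vs ids]) simp
  show ?thesis using S L eqv
  proof (induction S rule: finite_induct)
    case empty
    \<comment> \<open>The linearity of \<open>F\<close> says nothing about the empty sum directly: the zero map is \<open>0\<close> times the identity.\<close>
    have "descend d V V (\<lambda>p. 0) = hom_smult (tensor_power d V) (tensor_power d V) 0 (descend d V V (\<lambda>p. p))"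
      by (simp add: hom_smult_descend[OF vs vs ids])
    then show ?case using F_smult[OF idm, of 0] l_smult[OF F_mem[OF idm], of 0] by simp
  next
    case (insert e S)
    let ?R = "\<lambda>p. \<Sum>e\<in>S. scl (c e) (L e p)"
    have R: "tensorial d V V ?R" by (intro tensorial_sum tensorial_scl vs insert.prems(1)) simp
    have Rm: "descend d V V ?R \<in> Mor (Gamma d) V V"
      by (rule descend_in_Gamma[OF vs vs R])
         (simp add: insert.prems(2) free_linear_simps(2,6)[OF free_map_linear])
    have e: "tensorial d V V (L e)" by (simp add: insert.prems(1))
    have em: "descend d V V (L e) \<in> Mor (Gamma d) V V"
      by (rule descend_in_Gamma[OF vs vs e]) (simp add: insert.prems(2))
    have es: "tensorial d V V (\<lambda>p. scl (c e) (L e p))" by (rule tensorial_scl[OF vs e])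
    have esm: "descend d V V (\<lambda>p. scl (c e) (L e p)) \<in> Mor (Gamma d) V V"
      by (rule descend_in_Gamma[OF vs vs es])
         (simp add: insert.prems(2) free_linear_simps(2)[OF free_map_linear])
    have "descend d V V (\<lambda>p. \<Sum>e\<in>insert e S. scl (c e) (L e p))
      = hom_add (tensor_power d V) (tensor_power d V) (descend d V V (\<lambda>p. scl (c e) (L e p))) (descend d V V ?R)"
      by (simp add: hom_add_descend[OF vs vs es R] insert.hyps)
    then have "l (fmor F V V (descend d V V (\<lambda>p. \<Sum>e\<in>insert e S. scl (c e) (L e p))) x)
      = l (fmor F V V (descend d V V (\<lambda>p. scl (c e) (L e p))) x) + l (fmor F V V (descend d V V ?R) x)"
      by (simp add: F_add[OF esm Rm] l_add F_mem[OF esm] F_mem[OF Rm])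
    also have "l (fmor F V V (descend d V V (\<lambda>p. scl (c e) (L e p))) x) = c e * l (fmor F V V (descend d V V (L e)) x)"
      unfolding hom_smult_descend[OF vs vs e, symmetric] by (simp add: F_smult[OF em] l_smult F_mem[OF em])
    also have "l (fmor F V V (descend d V V ?R) x) = (\<Sum>e\<in>S. c e * l (fmor F V V (descend d V V (L e)) x))"
      by (rule insert.IH) (simp_all add: insert.prems)
    finally show ?case by (simp add: insert.hyps)
  qed
qed

lemma GL_simps:
  "T \<in> carrier (GL n) \<Longrightarrow> T \<in> carrier_mat n n"
  "\<one>\<^bsub>GL n\<^esub> = 1\<^sub>m n" "S \<otimes>\<^bsub>GL n\<^esub> T = S * T"
  by (auto simp: GL_def units_of_def Units_def ring_mat_simps)

text \<open>The polynomial has as its coefficients the matrix coefficients of \<open>F\<close> at the monomial maps, which do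
  not depend on \<open>T\<close>.\<close>

lemma ev_GL_homogeneous_polynomial:
  assumes F: "is_functor (Gamma d) Vect F" and lin: "K_linear d F"
  shows "homogeneous_polynomial_rep d n (fob (ev_GL d n) F)"
  unfolding homogeneous_polynomial_rep_def ev_GL_def homogeneous_polynomial_on_GL_def
proof (simp only: fctr.simps prod.case, intro ballI)
  fix l x
  assume l: "l \<in> module_hom class_ring (fob F (coord_space n)) line" and x: "x \<in> carrier (fob F (coord_space n))"
  show "\<exists>c. \<forall>T\<in>carrier (GL n).
      l (fmor F (coord_space n) (coord_space n) (tensor_map d (coord_space n) (coord_space n) (mat_map n T)) x)
      = (\<Sum>e\<in>word_types d n. c e * (\<Prod>ij\<in>{..<n} \<times> {..<n}. (T $$ ij) ^ e ij))"
  proof (intro exI ballI)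
    fix T :: "'a mat" assume "T \<in> carrier (GL n)"
    then have T: "T \<in> carrier_mat n n" by (rule GL_simps)
    have fin: "finite (word_types d n)"
      by (rule finite_subset[of _ "{..<n} \<times> {..<n} \<rightarrow>\<^sub>E {..d}"]) (auto simp: finite_PiE)
    show "l (fmor F (coord_space n) (coord_space n) (tensor_map d (coord_space n) (coord_space n) (mat_map n T)) x)
      = (\<Sum>e\<in>word_types d n. l (fmor F (coord_space n) (coord_space n)
           (descend d (coord_space n) (coord_space n) (monomial_map d n e)) x) * (\<Prod>ij\<in>{..<n} \<times> {..<n}. (T $$ ij) ^ e ij))"
      unfolding tensor_map_expand[OF T]
      by (subst K_linear_combination[OF F lin coord_space_obj fin tensorial_monomial_map monomial_map_equivariant x l])
         (simp_all add: mult.commute)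
  qed
qed


section \<open>Representations from functors\<close>

text \<open>Evaluation at an object carries an action on the object by endomorphisms to a representation; both
  evaluation functors arise in this way.\<close>

lemma functor_is_rep:
  assumes F: "is_functor C Vect F" and A: "A \<in> Obj C"
    and m: "\<And>g. g \<in> carrier G \<Longrightarrow> m g \<in> Mor C A A" and one: "m \<one>\<^bsub>G\<^esub> = Idm C A"
    and mult: "\<And>g h. g \<in> carrier G \<Longrightarrow> h \<in> carrier G \<Longrightarrow> m (g \<otimes>\<^bsub>G\<^esub> h) = Cmp C A A A (m g) (m h)"
  shows "is_rep G (fob F A, \<lambda>g. fmor F A A (m g))"
  unfolding is_rep_def
  using functor_obj[OF F A] functor_mor[OF F A A m] functor_id[OF F A] functor_cmp[OF F A A A m m]
  by (simp add: Vect_simps one mult)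

lemma nat_trans_intertwines:
  assumes F: "is_functor C Vect F" and A: "A \<in> Obj C" and e: "nat_trans C Vect F H \<eta>"
    and m: "f \<in> Mor C A A" and x: "x \<in> carrier (fob F A)"
  shows "\<eta> A (fmor F A A f x) = fmor H A A f (\<eta> A x)"
  using fun_cong[OF nat_trans_square[OF e A A m], of x] x by (simp add: Vect_simps compose_def)

text \<open>The inverse of a bijective intertwiner is again one.\<close>

lemma rep_cat_isoI:
  assumes f: "f \<in> Mor (rep_cat G P) R S" and iso: "is_iso Vect (fst R) (fst S) f"
    and R: "is_rep G R" and S: "is_rep G S"
  shows "is_iso (rep_cat G P) R S f"
proof -
  from iso obtain g where g: "g \<in> lin_maps (fst S) (fst R)"
    and gf: "compose (carrier (fst R)) g f = (\<lambda>x\<in>carrier (fst R). x)"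
    and fg: "compose (carrier (fst S)) f g = (\<lambda>x\<in>carrier (fst S). x)"
    unfolding is_iso_def by (auto simp: Vect_simps)
  have "g (snd S a y) = snd R a (g y)" if a: "a \<in> carrier G" and y: "y \<in> carrier (fst S)" for a y
  proof -
    have gy: "g y \<in> carrier (fst R)" using g y by (simp add: lin_maps_iff)
    then have ay: "snd R a (g y) \<in> carrier (fst R)" using R a by (auto simp: is_rep_def lin_maps_iff)
    have "f (g y) = y" using fun_cong[OF fg, of y] y by (simp add: compose_def)
    then have "snd S a y = f (snd R a (g y))" using f a gy by (simp add: rep_cat_simps)
    then show ?thesis using fun_cong[OF gf, of "snd R a (g y)"] ay by (simp add: compose_def)
  qed
  then have "g \<in> Mor (rep_cat G P) S R" using g by (simp add: rep_cat_simps)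
  then show ?thesis using f gf fg unfolding is_iso_def by (auto simp: rep_cat_simps)
qed

lemma ev_GL_functor: "is_functor (Rep_Gamma d) (Rep_GL d n) (ev_GL d n)"
proof (rule functor_intro, goal_cases)
  case 1 show ?case unfolding Rep_Gamma_def by (rule functor_cat_is_category)
next
  case 2 show ?case unfolding Rep_GL_def by (rule rep_cat_is_category)
next
  case (3 F)
  then have F: "is_functor (Gamma d) Vect F" and lin: "K_linear d F" by (simp_all add: Rep_Gamma_def functor_cat_simps)
  have "is_rep (GL n) (fob (ev_GL d n) F)"
    unfolding ev_GL_def fctr.simps
  proof (rule functor_is_rep[OF F coord_space_obj])
    show "tensor_map d (coord_space n) (coord_space n) (mat_map n T) \<in> Mor (Gamma d) (coord_space n) (coord_space n)"
      if "T \<in> carrier (GL n)" for T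
      by (intro tensor_map_in_Gamma coord_space_vectorspace mat_map_lin GL_simps that)
  qed (simp_all add: GL_simps mat_map_one tensor_map_id[OF coord_space_vectorspace] Gamma_simps mat_map_mult
      tensor_map_compose[OF coord_space_vectorspace coord_space_vectorspace coord_space_vectorspace] mat_map_lin
      del: coord_space_simps)
  then show ?case using ev_GL_homogeneous_polynomial[OF F lin] by (simp add: Rep_GL_def rep_cat_simps)
next
  case (4 F H \<eta>)
  then have F: "is_functor (Gamma d) Vect F" and e: "nat_trans (Gamma d) Vect F H \<eta>"
    by (simp_all add: Rep_Gamma_def functor_cat_simps)
  have "tensor_map d (coord_space n) (coord_space n) (mat_map n T) \<in> Mor (Gamma d) (coord_space n) (coord_space n)"
    if "T \<in> carrier (GL n)" for T
    by (intro tensor_map_in_Gamma coord_space_vectorspace mat_map_lin GL_simps that)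
  note act = nat_trans_intertwines[OF F coord_space_obj e this]
  show ?case
    using nat_trans_mor[OF e coord_space_obj] act
    by (simp add: ev_GL_def Rep_GL_def rep_cat_simps Vect_simps)
next
  case (5 F) show ?case
    by (simp add: ev_GL_def Rep_Gamma_def functor_cat_simps coord_space_obj Rep_GL_def rep_cat_simps Vect_simps)
next
  case (6 F H K \<eta> \<epsilon>) show ?case
    by (simp add: ev_GL_def Rep_Gamma_def functor_cat_simps coord_space_obj Rep_GL_def rep_cat_simps Vect_simps)
qed

abbreviation std_perm :: "nat \<Rightarrow> (nat \<Rightarrow> nat) \<Rightarrow> nat + 'a \<Rightarrow> nat + 'a" where
  "std_perm n \<sigma> \<equiv> (\<lambda>a\<in>std_set n. Inl (\<sigma> (projl a)))"

lemma std_perm_FI: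
  assumes "\<sigma> permutes {1..n}" shows "std_perm n \<sigma> \<in> Mor FI (std_set n) (std_set n)"
proof -
  have "\<sigma> k \<in> {1..n}" if "k \<in> {1..n}" for k using permutes_in_image[OF assms] that by blast
  then have "std_perm n \<sigma> \<in> std_set n \<rightarrow>\<^sub>E std_set n"
    by (auto simp: std_set_def simp del: atLeastAtMost_iff)
  moreover have "inj_on (std_perm n \<sigma>) (std_set n)"
  proof (rule inj_onI)
    fix a b assume ab: "a \<in> std_set n" "b \<in> std_set n" "std_perm n \<sigma> a = std_perm n \<sigma> b"
    then have "\<sigma> (projl a) = \<sigma> (projl b)" by simp
    then have "projl a = projl b" by (rule injD[OF permutes_inj[OF assms]])
    then show "a = b" using ab(1,2) by (auto simp: std_set_def)
  qed
  ultimately show ?thesis by (simp add: FI_simps)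
qed

lemma std_set_obj: "std_set n \<in> Obj FI"
  by (simp add: FI_simps std_set_def)

lemma ev_FI_functor: "is_functor FI_Mod (Rep_S n) (ev_FI n)"
proof (rule functor_intro, goal_cases)
  case 1 show ?case unfolding FI_Mod_def by (rule functor_cat_is_category)
next
  case 2 show ?case unfolding Rep_S_def by (rule rep_cat_is_category)
next
  case (3 F)
  then have F: "is_functor FI Vect F" by (simp add: FI_Mod_def functor_cat_simps)
  have "is_rep (sym_group n) (fob (ev_FI n) F)"
    unfolding ev_FI_def fctr.simps
  proof (rule functor_is_rep[OF F std_set_obj])
    show "std_perm n \<sigma> \<in> Mor FI (std_set n) (std_set n)" if "\<sigma> \<in> carrier (sym_group n)" for \<sigma>
      by (rule std_perm_FI) (use that in \<open>simp add: sym_group_def\<close>)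
    show "std_perm n \<one>\<^bsub>sym_group n\<^esub> = Idm FI (std_set n)"
      by (auto simp: FI_simps sym_group_def std_set_def intro!: restrict_ext)
    show "std_perm n (\<sigma> \<otimes>\<^bsub>sym_group n\<^esub> \<tau>) = Cmp FI (std_set n) (std_set n) (std_set n) (std_perm n \<sigma>) (std_perm n \<tau>)"
      if "\<sigma> \<in> carrier (sym_group n)" "\<tau> \<in> carrier (sym_group n)" for \<sigma> \<tau>
    proof -
      have "\<tau> k \<in> {1..n}" if "k \<in> {1..n}" for k
        using permutes_in_image[of \<tau> "{1..n}"] \<open>\<tau> \<in> carrier (sym_group n)\<close> that unfolding sym_group_carrier by blast
      then show ?thesis
        by (auto simp: FI_simps sym_group_mult std_set_def compose_def simp del: atLeastAtMost_iff intro!: restrict_ext)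
    qed
  qed
  then show ?case by (simp add: Rep_S_def rep_cat_simps)
next
  case (4 F H \<eta>)
  then have F: "is_functor FI Vect F" and e: "nat_trans FI Vect F H \<eta>"
    by (simp_all add: FI_Mod_def functor_cat_simps)
  have "std_perm n \<sigma> \<in> Mor FI (std_set n) (std_set n)" if "\<sigma> \<in> carrier (sym_group n)" for \<sigma>
    by (rule std_perm_FI) (use that in \<open>simp add: sym_group_def\<close>)
  note act = nat_trans_intertwines[OF F std_set_obj e this]
  show ?case
    using nat_trans_mor[OF e std_set_obj] act
    by (simp add: ev_FI_def Rep_S_def rep_cat_simps Vect_simps)
next
  case (5 F) show ?case
    by (simp add: ev_FI_def FI_Mod_def functor_cat_simps std_set_obj Rep_S_def rep_cat_simps Vect_simps)
next
  case (6 F H K \<eta> \<epsilon>) show ?case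
    by (simp add: ev_FI_def FI_Mod_def functor_cat_simps std_set_obj Rep_S_def rep_cat_simps Vect_simps)
qed

lemma Res_FI_functor:
  "is_functor (Rep_Gamma d) FI_Mod
     (Res_FI d :: (('k::field, 'a, 'x, 'w) spf, ('k, 'a, 'x, 'w) spf_trans,
                   ('k, nat + 'a, 'w) FI_fctr, (nat + 'a) set \<Rightarrow> 'w \<Rightarrow> 'w) fctr)"
proof (rule functor_intro, goal_cases)
  case 1 show ?case unfolding Rep_Gamma_def by (rule functor_cat_is_category)
next
  case 2 show ?case unfolding FI_Mod_def by (rule functor_cat_is_category)
next
  case (3 F) then show ?case
    using functor_fctr_comp[OF fun_fctr_functor, where G = F and E = Vect]
    by (simp add: Res_FI_def Rep_Gamma_def FI_Mod_def functor_cat_simps)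
next
  case (4 F H \<eta>)
  then have e: "nat_trans (Gamma d) Vect F H \<eta>" by (simp add: Rep_Gamma_def functor_cat_simps)
  have "tensor_map d (fun_space A) (fun_space B) (fun_map A B i)
      \<in> Mor (Gamma d) (fun_space A) (fun_space B :: ('k, ('k, 'a, 'x) point) module)" for A B i
    by (intro tensor_map_in_Gamma fun_space_vectorspace fun_map_lin)
  then show ?case using nat_trans_mor[OF e fun_space_obj] nat_trans_square[OF e fun_space_obj fun_space_obj]
    by (simp add: Res_FI_def FI_Mod_def functor_cat_simps nat_trans_def fctr_comp_def fun_fctr_def FI_simps)
next
  case (5 F) show ?case
    by (auto simp: Res_FI_def Rep_Gamma_def FI_Mod_def functor_cat_simps fctr_comp_def fun_fctr_def FI_simps
        fun_space_obj intro!: restrict_ext)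
next
  case (6 F H K \<eta> \<epsilon>) show ?case
    by (auto simp: Res_FI_def Rep_Gamma_def FI_Mod_def functor_cat_simps fctr_comp_def fun_fctr_def FI_simps
        fun_space_obj intro!: restrict_ext)
qed


section \<open>Permutation matrices\<close>

text \<open>The passage between the points \<open>{1..n}\<close> and the indices below \<open>n\<close>.\<close>

lemma permutes_Suc:
  assumes "\<sigma> permutes {1..n}" "j < n" obtains k where "k < n" "\<sigma> (Suc j) = Suc k"
proof -
  have "\<sigma> (Suc j) \<in> {1..n}" using permutes_in_image[OF assms(1), of "Suc j"] assms(2) by simp
  then show thesis by (intro that[of "\<sigma> (Suc j) - 1"]) auto
qed

lemma perm_mat_carrier: "perm_mat n \<sigma> \<in> carrier_mat n n"
  by (simp add: perm_mat_def)

lemma perm_mat_id: "perm_mat n id = 1\<^sub>m n"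
  by (rule eq_matI) (auto simp: perm_mat_def)

lemma perm_mat_mult:
  assumes "\<tau> permutes {1..n}"
  shows "perm_mat n (\<sigma> \<circ> \<tau>) = perm_mat n \<sigma> * (perm_mat n \<tau> :: 'k::field mat)"
proof (rule eq_matI)
  fix i j assume "i < dim_row (perm_mat n \<sigma> * (perm_mat n \<tau> :: 'k mat))" "j < dim_col (perm_mat n \<sigma> * (perm_mat n \<tau> :: 'k mat))"
  then have ij: "i < n" "j < n" by (simp_all add: perm_mat_def)
  obtain k where k: "k < n" "\<tau> (Suc j) = Suc k" by (rule permutes_Suc[OF assms ij(2)])
  have "(perm_mat n \<sigma> * (perm_mat n \<tau> :: 'k mat)) $$ (i, j)
    = (\<Sum>l = 0..<n. (if Suc i = \<sigma> (Suc l) then 1 else 0) * (if l = k then 1 else 0))"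
    using ij k by (simp add: perm_mat_def scalar_prod_def)
  also have "\<dots> = (\<Sum>l = 0..<n. if l = k then (if Suc i = \<sigma> (Suc k) then 1 else 0) else 0)"
    by (rule sum.cong) auto
  finally show "perm_mat n (\<sigma> \<circ> \<tau>) $$ (i, j) = (perm_mat n \<sigma> * (perm_mat n \<tau> :: 'k mat)) $$ (i, j)"
    using ij k by (simp add: perm_mat_def)
qed (simp_all add: perm_mat_def)

lemma perm_mat_GL:
  assumes "\<sigma> permutes {1..n}" shows "(perm_mat n \<sigma> :: 'k::field mat) \<in> carrier (GL n)"
proof -
  have "perm_mat n (inv' \<sigma>) * (perm_mat n \<sigma> :: 'k mat) = 1\<^sub>m n"
    using perm_mat_mult[OF assms, of "inv' \<sigma>", where 'k = 'k] permutes_inv_o(2)[OF assms] by (simp add: perm_mat_id)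
  moreover have "perm_mat n \<sigma> * (perm_mat n (inv' \<sigma>) :: 'k mat) = 1\<^sub>m n"
    using perm_mat_mult[OF permutes_inv[OF assms], of \<sigma>, where 'k = 'k] permutes_inv_o(1)[OF assms] by (simp add: perm_mat_id)
  ultimately show ?thesis
    by (auto simp: GL_def units_of_def Units_def ring_mat_simps perm_mat_carrier
        intro!: bexI[of _ "perm_mat n (inv' \<sigma>)"])
qed

lemma perm_mat_mult_vec:
  assumes v: "v \<in> carrier_vec n" and \<sigma>: "\<sigma> permutes {1..n}" and j: "j < n" and i: "\<sigma> (Suc j) = Suc i" "i < n"
  shows "(perm_mat n \<sigma> *\<^sub>v v) $ i = (v $ j :: 'k::field)"
proof -
  have "Suc i = \<sigma> (Suc l) \<longleftrightarrow> l = j" for l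
    using permutes_inj[OF \<sigma>] i(1) by (metis injD nat.inject)
  then have "(perm_mat n \<sigma> *\<^sub>v v) $ i = (\<Sum>l = 0..<n. (if l = j then 1 else 0) * v $ l)"
    using i v by (simp add: perm_mat_def scalar_prod_def)
  also have "\<dots> = (\<Sum>l = 0..<n. if l = j then v $ j else 0)" by (rule sum.cong) auto
  finally show ?thesis using j by simp
qed

lemma Res_S_functor:
  "is_functor (Rep_GL d n) (Rep_S n)
     (Res_S n :: (('k::field, 'k mat, 'w) repr, 'w \<Rightarrow> 'w, ('k, nat \<Rightarrow> nat, 'w) repr, 'w \<Rightarrow> 'w) fctr)"
proof (rule functor_intro, goal_cases)
  case 1 show ?case unfolding Rep_GL_def by (rule rep_cat_is_category)
next
  case 2 show ?case unfolding Rep_S_def by (rule rep_cat_is_category)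
next
  case (3 R)
  obtain W \<rho> where R: "R = (W, \<rho>)" by force
  have rep: "is_rep (GL n) (W, \<rho>)" using 3 by (simp add: R Rep_GL_def rep_cat_simps)
  have "is_rep (sym_group n) (W, \<lambda>\<sigma>. \<rho> (perm_mat n \<sigma>))"
    unfolding is_rep_def prod.case
  proof (intro conjI ballI)
    show "vectorspace class_ring W" using rep by (simp add: is_rep_def)
    show "\<rho> (perm_mat n \<sigma>) \<in> lin_maps W W" if "\<sigma> \<in> carrier (sym_group n)" for \<sigma>
      using rep that perm_mat_GL[of \<sigma> n, where 'k = 'k] unfolding sym_group_carrier by (simp add: is_rep_def)
    show "\<rho> (perm_mat n \<one>\<^bsub>sym_group n\<^esub>) = (\<lambda>x\<in>carrier W. x)"
      using rep by (simp add: is_rep_def sym_group_one perm_mat_id GL_simps)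
    show "\<rho> (perm_mat n (\<sigma> \<otimes>\<^bsub>sym_group n\<^esub> \<tau>)) = compose (carrier W) (\<rho> (perm_mat n \<sigma>)) (\<rho> (perm_mat n \<tau>))"
      if "\<sigma> \<in> carrier (sym_group n)" "\<tau> \<in> carrier (sym_group n)" for \<sigma> \<tau>
    proof -
      have "(perm_mat n \<sigma> :: 'k mat) \<in> carrier (GL n)" "(perm_mat n \<tau> :: 'k mat) \<in> carrier (GL n)"
        "(perm_mat n (\<sigma> \<circ> \<tau>) :: 'k mat) = perm_mat n \<sigma> \<otimes>\<^bsub>GL n\<^esub> perm_mat n \<tau>"
        using that perm_mat_GL[of \<sigma> n, where 'k = 'k] perm_mat_GL[of \<tau> n, where 'k = 'k]
          perm_mat_mult[of \<tau> n \<sigma>, where 'k = 'k]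
        unfolding sym_group_carrier by (simp_all add: GL_simps)
      then show ?thesis using rep by (simp add: is_rep_def sym_group_mult)
    qed
  qed
  then show ?case by (simp add: R Res_S_def Rep_S_def rep_cat_simps)
next
  case (4 R S f) then show ?case using perm_mat_GL[where n = n and 'k = 'k]
    by (auto simp: Res_S_def Rep_GL_def Rep_S_def rep_cat_simps sym_group_def case_prod_unfold)
next
  case (5 R) show ?case by (simp add: Res_S_def Rep_GL_def Rep_S_def rep_cat_simps case_prod_unfold)
next
  case (6 R S T f g) show ?case by (simp add: Res_S_def Rep_GL_def Rep_S_def rep_cat_simps case_prod_unfold)
qed


section \<open>The comparison isomorphism\<close>

abbreviation std_enum :: "nat \<Rightarrow> nat + 'a" where
  "std_enum i \<equiv> Inl (Suc i)"

lemma std_enum_bij: "bij_betw std_enum {..<n} (std_set n)"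
proof -
  have "{1..n} = Suc ` {..<n}" by (simp add: image_Suc_lessThan)
  then have "std_set n = (\<lambda>i. std_enum i :: nat + 'a) ` {..<n}" by (simp add: std_set_def image_image)
  then show ?thesis by (simp add: bij_betw_def inj_on_def)
qed

abbreviation std_iso :: "nat \<Rightarrow> ('k::field, 'a, 'x) point \<Rightarrow> ('k, 'a, 'x) point" where
  "std_iso n \<equiv> coord_to_fun n (std_set n) std_enum"

text \<open>Permuting the coordinates of a vector and moving the values of a function along a bijection are the
  same operation: both send the value at \<open>j\<close> to the place \<open>\<sigma> j\<close>.\<close>

lemma std_iso_equivariant:
  assumes \<sigma>: "\<sigma> permutes {1..n}"
  shows "compose (carrier (coord_space n)) (std_iso n) (mat_map n (perm_mat n \<sigma>))
    = compose (carrier (coord_space n)) (fun_map (std_set n) (std_set n) (std_perm n \<sigma>))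
       (std_iso n :: ('k::field, 'a, 'x) point \<Rightarrow> ('k, 'a, 'x) point)"
proof (rule extensionalityI)
  fix x :: "('k, 'a, 'x) point" assume "x \<in> carrier (coord_space n)"
  then obtain v where v: "v \<in> carrier_vec n" "x = Vec v" by auto
  have bij: "bij_betw (std_enum :: nat \<Rightarrow> nat + 'a) {..<n} (std_set n)" by (rule std_enum_bij)
  have enum: "inv_into {..<n} std_enum (std_enum i :: nat + 'a) = i" if "i < n" for i
    using inv_into_f_f[OF bij_betw_imp_inj_on[OF bij], of i] that by simp
  have P: "inj_on (std_perm n \<sigma> :: nat + 'a \<Rightarrow> _) (std_set n)" "(std_perm n \<sigma> :: nat + 'a \<Rightarrow> _) \<in> std_set n \<rightarrow> std_set n"
    using std_perm_FI[OF \<sigma>] by (auto simp: FI_simps)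
  have val: "std_iso n (Vec u :: ('k, 'a, 'x) point) = Fn (\<lambda>a\<in>std_set n. u $ inv_into {..<n} std_enum a)" if "u \<in> carrier_vec n" for u
    using that by (simp add: coord_to_fun_def)
  define u where "u = (\<lambda>a\<in>std_set n. v $ inv_into {..<n} (std_enum :: nat \<Rightarrow> nat + 'a) a)"
  define s :: "nat + 'a \<Rightarrow> nat + 'a" where "s = std_perm n \<sigma>"
  have x: "std_iso n x = Fn u" using val[OF v(1)] by (simp add: v(2) u_def)
  have u: "u \<in> std_set n \<rightarrow>\<^sub>E UNIV" by (simp add: u_def)
  obtain g where g: "fun_map (std_set n) (std_set n) s (std_iso n x) = Fn g" "g \<in> std_set n \<rightarrow>\<^sub>E UNIV"
    "\<And>a. a \<in> std_set n \<Longrightarrow> g (s a) = u a"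
  proof (rule fun_map_apply[OF P[folded s_def] u])
    fix g assume h: "fun_map (std_set n) (std_set n) s (Fn u :: ('k, 'a, 'x) point) = Fn g" "g \<in> std_set n \<rightarrow>\<^sub>E UNIV"
      "\<And>a. a \<in> std_set n \<Longrightarrow> g (s a) = u a"
    show thesis by (rule that[of g]) (simp_all add: x h)
  qed
  have "(\<lambda>a\<in>std_set n. (perm_mat n \<sigma> *\<^sub>v v) $ inv_into {..<n} std_enum a) = g"
  proof (rule PiE_ext[OF _ g(2)])
    fix a :: "nat + 'a" assume a: "a \<in> std_set n"
    then obtain i where i: "i < n" "a = std_enum i" using bij by (auto simp: bij_betw_def)
    obtain j where j: "j < n" "inv' \<sigma> (Suc i) = Suc j" by (rule permutes_Suc[OF permutes_inv[OF \<sigma>] i(1)])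
    have \<sigma>j: "\<sigma> (Suc j) = Suc i" using j(2) permutes_inverses(1)[OF \<sigma>, of "Suc i"] by simp
    have jn: "(std_enum j :: nat + 'a) \<in> std_set n" using j(1) by (simp add: std_set_def image_iff)
    have "g a = v $ j" using g(3)[OF jn] jn \<sigma>j enum[OF j(1)] by (simp add: i(2) s_def u_def)
    then show "(\<lambda>a\<in>std_set n. (perm_mat n \<sigma> *\<^sub>v v) $ inv_into {..<n} std_enum a) a = g a"
      using a enum[OF i(1)] perm_mat_mult_vec[OF v(1) \<sigma> j(1) \<sigma>j i(1)] by (simp add: i(2))
  qed simp
  moreover have "perm_mat n \<sigma> *\<^sub>v v \<in> carrier_vec n"
    using mult_mat_vec_carrier[OF perm_mat_carrier v(1)] .
  ultimately show "compose (carrier (coord_space n)) (std_iso n) (mat_map n (perm_mat n \<sigma>)) x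
    = compose (carrier (coord_space n)) (fun_map (std_set n) (std_set n) (std_perm n \<sigma>)) (std_iso n) x"
    using g(1) v by (simp add: compose_def mat_map_def val s_def)
qed simp_all

text \<open>Tensor powers are functorial, so they preserve the isomorphism of the underlying spaces.\<close>

lemma std_iso_Gamma:
  "is_iso (Gamma d) (coord_space n) (fun_space (std_set n))
     (tensor_map d (coord_space n) (fun_space (std_set n)) (std_iso n))"
proof -
  note h = coord_fun_iso[OF std_enum_bij[of n]]
  note c = coord_space_vectorspace[of n] and f = fun_space_vectorspace[of "std_set n"]
  let ?g = "tensor_map d (fun_space (std_set n)) (coord_space n) (fun_to_coord n (std_set n) std_enum)"
  show ?thesis unfolding is_iso_def
  proof (intro conjI bexI[of _ ?g])
    show "tensor_map d (coord_space n) (fun_space (std_set n)) (std_iso n) \<in> Mor (Gamma d) (coord_space n) (fun_space (std_set n))"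
      by (rule tensor_map_in_Gamma[OF c f h(1)])
    show "?g \<in> Mor (Gamma d) (fun_space (std_set n)) (coord_space n)"
      by (rule tensor_map_in_Gamma[OF f c h(2)])
  qed (simp_all only: Gamma_simps(3,4) tensor_map_compose[OF c f c h(1,2)] tensor_map_compose[OF f c f h(2,1)] h(3,4)
      tensor_map_id[OF c] tensor_map_id[OF f])
qed

text \<open>The component at \<open>F\<close> is \<open>F\<close> applied to an isomorphism of \<open>\<Gamma>\<^sup>d\<close> that does not depend on \<open>F\<close>. So it is
  invertible and intertwines because functors preserve isomorphisms and composition, and it is natural
  in \<open>F\<close> because that is the naturality of a morphism \<open>F \<rightarrow> H\<close> at this isomorphism.\<close>

lemma restriction_square:
  "naturally_isomorphic
     (Rep_Gamma d :: (('k::field, 'a, 'x, 'w) spf, ('k, 'a, 'x, 'w) spf_trans) category) (Rep_S n)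
     (fctr_comp (Res_S n) (ev_GL d n))
     (fctr_comp (ev_FI n :: (('k, nat + 'a, 'w) FI_fctr, (nat + 'a) set \<Rightarrow> 'w \<Rightarrow> 'w,
                               ('k, nat \<Rightarrow> nat, 'w) repr, 'w \<Rightarrow> 'w) fctr) (Res_FI d))"
proof -
  let ?C = "coord_space n :: ('k, ('k, 'a, 'x) point) module"
  let ?A = "std_set n :: (nat + 'a) set"
  let ?E = "fun_space ?A :: ('k, ('k, 'a, 'x) point) module"
  let ?t = "tensor_map d ?C ?E (std_iso n)"
  let ?R = "Rep_Gamma d :: (('k, 'a, 'x, 'w) spf, ('k, 'a, 'x, 'w) spf_trans) category"
  let ?L = "fctr_comp (Res_S n) (ev_GL d n) :: (('k, 'a, 'x, 'w) spf, ('k, 'a, 'x, 'w) spf_trans, ('k, nat \<Rightarrow> nat, 'w) repr, 'w \<Rightarrow> 'w) fctr"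
  let ?M = "fctr_comp (ev_FI n :: (('k, nat + 'a, 'w) FI_fctr, (nat + 'a) set \<Rightarrow> 'w \<Rightarrow> 'w,
                               ('k, nat \<Rightarrow> nat, 'w) repr, 'w \<Rightarrow> 'w) fctr) (Res_FI d) :: (('k, 'a, 'x, 'w) spf, _, _, _) fctr"
  let ?\<eta> = "\<lambda>F\<in>Obj ?R. fmor F ?C ?E ?t"
  have L: "is_functor ?R (Rep_S n) ?L" by (rule functor_fctr_comp[OF ev_GL_functor Res_S_functor])
  have M: "is_functor ?R (Rep_S n) ?M" by (rule functor_fctr_comp[OF Res_FI_functor ev_FI_functor])
  have C: "?C \<in> Obj (Gamma d)" by (rule coord_space_obj)
  have E: "?E \<in> Obj (Gamma d)" by (rule fun_space_obj) (simp add: std_set_def)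
  have t: "?t \<in> Mor (Gamma d) ?C ?E" 
    by (rule tensor_map_in_Gamma[OF coord_space_vectorspace fun_space_vectorspace coord_fun_iso(1)[OF std_enum_bij]])
  have fobL: "fob ?L F = (fob F ?C, \<lambda>\<sigma>. fmor F ?C ?C (tensor_map d ?C ?C (mat_map n (perm_mat n \<sigma>))))" for F
    by (simp add: fctr_comp_def Res_S_def ev_GL_def)
  have fobM: "fob ?M F = (fob F ?E, \<lambda>\<sigma>. fmor F ?E ?E (tensor_map d ?E ?E (fun_map ?A ?A (std_perm n \<sigma>))))" for F
    by (simp add: fctr_comp_def ev_FI_def Res_FI_def fun_fctr_def)
  have mor: "?\<eta> F \<in> Mor (Rep_S n) (fob ?L F) (fob ?M F)" and iso: "is_iso (Rep_S n) (fob ?L F) (fob ?M F) (?\<eta> F)"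
    if FR: "F \<in> Obj ?R" for F
  proof -
    have F: "is_functor (Gamma d) Vect F" using FR by (simp add: Rep_Gamma_def functor_cat_simps)
    have eqv: "fmor F ?C ?E ?t (snd (fob ?L F) \<sigma> x) = snd (fob ?M F) \<sigma> (fmor F ?C ?E ?t x)"
      if s: "\<sigma> \<in> carrier (sym_group n)" and x: "x \<in> carrier (fob F ?C)" for \<sigma> x
    proof -
      have \<sigma>: "\<sigma> permutes {1..n}" using s by (simp only: sym_group_carrier)
      let ?p = "tensor_map d ?C ?C (mat_map n (perm_mat n \<sigma>))"
      let ?q = "tensor_map d ?E ?E (fun_map ?A ?A (std_perm n \<sigma>))"
      note c = coord_space_vectorspace and f = fun_space_vectorspace
      note h = coord_fun_iso(1)[OF std_enum_bij]
      have p: "?p \<in> Mor (Gamma d) ?C ?C" by (intro tensor_map_in_Gamma c mat_map_lin perm_mat_carrier)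
      have q: "?q \<in> Mor (Gamma d) ?E ?E" by (intro tensor_map_in_Gamma f fun_map_lin)
      have "Cmp (Gamma d) ?C ?C ?E ?t ?p = Cmp (Gamma d) ?C ?E ?E ?q ?t"
        unfolding Gamma_simps tensor_map_compose[OF c c f mat_map_lin[OF perm_mat_carrier] h]
          tensor_map_compose[OF c f f h fun_map_lin] std_iso_equivariant[OF \<sigma>] ..
      then have "Cmp Vect (fob F ?C) (fob F ?C) (fob F ?E) (fmor F ?C ?E ?t) (fmor F ?C ?C ?p)
        = Cmp Vect (fob F ?C) (fob F ?E) (fob F ?E) (fmor F ?E ?E ?q) (fmor F ?C ?E ?t)"
        using functor_cmp[OF F C C E p t] functor_cmp[OF F C E E t q] by simp
      from fun_cong[OF this, of x] show ?thesis using x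
        by (simp add: Vect_simps compose_def fobL fobM)
    qed
    have "fmor F ?C ?E ?t \<in> lin_maps (fob F ?C) (fob F ?E)" using functor_mor[OF F C E t] by (simp add: Vect_simps)
    then show m: "?\<eta> F \<in> Mor (Rep_S n) (fob ?L F) (fob ?M F)"
      using eqv FR by (simp add: Rep_S_def rep_cat_simps fobL fobM)
    have "is_iso Vect (fob F ?C) (fob F ?E) (?\<eta> F)"
      using functor_preserves_iso[OF F C E std_iso_Gamma] FR by simp
    then show "is_iso (Rep_S n) (fob ?L F) (fob ?M F) (?\<eta> F)"
      using m functor_obj[OF L FR] functor_obj[OF M FR] unfolding Rep_S_def
      by (intro rep_cat_isoI) (simp_all add: rep_cat_simps fobL fobM)
  qed
  have "nat_trans ?R (Rep_S n) ?L ?M ?\<eta>"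
    unfolding nat_trans_def
  proof (intro conjI ballI)
    show "?\<eta> F \<in> Mor (Rep_S n) (fob ?L F) (fob ?M F)" if "F \<in> Obj ?R" for F by (rule mor[OF that])
    fix F H \<epsilon> assume F: "F \<in> Obj ?R" and H: "H \<in> Obj ?R" and "\<epsilon> \<in> Mor ?R F H"
    then have e: "nat_trans (Gamma d) Vect F H \<epsilon>" by (simp add: Rep_Gamma_def functor_cat_simps)
    have "fmor ?L F H \<epsilon> = \<epsilon> ?C" by (simp add: fctr_comp_def Res_S_def ev_GL_def)
    moreover have "fmor ?M F H \<epsilon> = \<epsilon> ?E"
      by (simp add: fctr_comp_def ev_FI_def Res_FI_def FI_simps std_set_def)
    ultimately show "Cmp (Rep_S n) (fob ?L F) (fob ?L H) (fob ?M H) (?\<eta> H) (fmor ?L F H \<epsilon>)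
      = Cmp (Rep_S n) (fob ?L F) (fob ?M F) (fob ?M H) (fmor ?M F H \<epsilon>) (?\<eta> F)"
      using nat_trans_square[OF e C E t] F H by (simp add: Rep_S_def rep_cat_simps fobL Vect_simps)
  qed simp
  then show ?thesis using L M iso unfolding naturally_isomorphic_def by blast
qed

theorem theorem5p1:
  fixes n d :: nat
  assumes "n \<ge> 1" and "d \<ge> 1"
  shows
    "is_functor (Rep_Gamma d) (Rep_GL d n)
       (ev_GL d n :: (('k::field, 'a, 'x, 'w) spf, ('k, 'a, 'x, 'w) spf_trans,
                      ('k, 'k mat, 'w) repr, 'w \<Rightarrow> 'w) fctr) \<and>
     is_functor (Rep_GL d n) (Rep_S n)
       (Res_S n :: (('k, 'k mat, 'w) repr, 'w \<Rightarrow> 'w,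
                    ('k, nat \<Rightarrow> nat, 'w) repr, 'w \<Rightarrow> 'w) fctr) \<and>
     is_functor (Rep_Gamma d) FI_Mod
       (Res_FI d :: (('k, 'a, 'x, 'w) spf, ('k, 'a, 'x, 'w) spf_trans,
                     ('k, nat + 'a, 'w) FI_fctr, (nat + 'a) set \<Rightarrow> 'w \<Rightarrow> 'w) fctr) \<and>
     is_functor FI_Mod (Rep_S n)
       (ev_FI n :: (('k, nat + 'a, 'w) FI_fctr, (nat + 'a) set \<Rightarrow> 'w \<Rightarrow> 'w,
                    ('k, nat \<Rightarrow> nat, 'w) repr, 'w \<Rightarrow> 'w) fctr) \<and>
     naturally_isomorphic
       (Rep_Gamma d :: (('k, 'a, 'x, 'w) spf, ('k, 'a, 'x, 'w) spf_trans) category)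
       (Rep_S n)
       (fctr_comp (Res_S n) (ev_GL d n))
       (fctr_comp (ev_FI n :: (('k, nat + 'a, 'w) FI_fctr, (nat + 'a) set \<Rightarrow> 'w \<Rightarrow> 'w,
                               ('k, nat \<Rightarrow> nat, 'w) repr, 'w \<Rightarrow> 'w) fctr)
                  (Res_FI d))"
  using ev_GL_functor Res_S_functor Res_FI_functor ev_FI_functor restriction_square
  by (intro conjI)

end
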